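(* Let $P^{(C_n,C_n)}_{(1^r)}(x\,|\,b;q,t)=P_{(1^r)}(x\,|\,b^{1/2},-b^{1/2},q^{1/2}b^{1/2},-q^{1/2}b^{1/2}\,|\,q,t)$ be the one-column Macdonald polynomials of type $(C_n,C_n)$, and let $s^{(C_n)}_{(1^r)}(x)=P^{(C_n,C_n)}_{(1^r)}(x\,|\,q;q,q)$ be the type $C_n$ Schur polynomials (the case $b=t=q$). In this case (that is, for $a=q^{1/2}$, $c=q$, $t=q$) the function $$f(s)=\frac{(1-1/s)\big(1-t^{2}/(s a^2c^2)\big)\big(1+t/(s a^2)\big)\big(1+t/(sc^2)\big)}{\big(1-t/(s^{2}a^2c^2)\big)\big(1-t^{3}/(s^{2}a^2c^2)\big)}$$ satisfies $f(t^{i+1})=1$ for all $i\ge0$, and for $0\le r\le n$ $$s^{(C_n)}_{(1^r)}(x)=P^{(C_n,C_n)}_{(1^r)}(x\,|\,q;q,q)=\sum_{k=0}^{\lfloor r/2\rfloor}\frac{n-r+1}{n-r+k+1}\binom{n-r+2k}{k}\,m_{(1^{r-2k})}(x).$$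
   Context: Koornwinder polynomials. Let $n\ge1$, $x=(x_1,\dots,x_n)$, and let $a,b,c,d,q,t$ be generic complex parameters, $|q|<1$; put $\alpha=(abcd/q)^{1/2}$. The group $W_n=\mathbb{Z}_2^n\rtimes\mathfrak{S}_n$ acts on Laurent polynomials by permuting the variables and inverting $x_i\mapsto x_i^{-1}$. For a partition $\lambda=(\lambda_1\ge\dots\ge\lambda_n\ge0)$, $m_\lambda=m_\lambda(x)$ is the sum of the distinct monomials $x^\mu$, $\mu$ in the $W_n$-orbit of $\lambda$. Let $T_{q,x_i}^{\pm1}$ replace $x_i$ by $q^{\pm1}x_i$, and set $$\mathcal{D}_x=\sum_{i=1}^n\frac{(1-ax_i)(1-bx_i)(1-cx_i)(1-dx_i)}{\alpha t^{n-1}(1-x_i^2)(1-qx_i^2)}\prod_{j\ne i}\frac{(1-tx_ix_j)(1-tx_i/x_j)}{(1-x_ix_j)(1-x_i/x_j)}\big(T_{q,x_i}-1\big)$$ $$\qquad+\sum_{i=1}^n\frac{(1-a/x_i)(1-b/x_i)(1-c/x_i)(1-d/x_i)}{\alpha t^{n-1}(1-1/x_i^2)(1-q/x_i^2)}\prod_{j\ne i}\frac{(1-tx_j/x_i)(1-t/(x_ix_j))}{(1-x_j/x_i)(1-1/(x_ix_j))}\big(T_{q,x_i}^{-1}-1\big).$$ The Koornwinder polynomial $P_\lambda(x\,|\,a,b,c,d\,|\,q,t)$ is the unique $W_n$-invariant Laurent polynomial with $P_\lambda=m_\lambda+$ (linear combination of $m_\mu$, $\mu<\lambda$ in dominance order: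 $\mu_1+\dots+\mu_i\le\lambda_1+\dots+\lambda_i$ for all $i$) and $\mathcal{D}_xP_\lambda=d_\lambda P_\lambda$, where $d_\lambda=\sum_{j=1}^n\big(\alpha t^{n-j}q^{\lambda_j}+\alpha^{-1}t^{-n+j}q^{-\lambda_j}-\alpha t^{n-j}-\alpha^{-1}t^{-n+j}\big)$. Here $(1^r)$ is the partition with $r$ parts equal to $1$, $(1^0)=\varnothing$, $m_\varnothing=1$, and $\binom{m}{j}=m(m-1)\cdots(m-j+1)/j!$. In the function $f$ the parameters $a,c$ correspond to writing the type $(C_n,C_n)$ parameters as $(a,-a,c,-c)$ with $a=b^{1/2}$, $c=q^{1/2}b^{1/2}$. *)

theory Defs
  imports Complex_Main "HOL-Library.Poly_Mapping" "HOL-Combinatorics.Permutations"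
begin

section \<open>Laurent polynomials\<close>

text \<open>
  Exponent vectors are finitely supported functions from the variable indices to the integers; the
  variables of an \<open>n\<close>-variable Laurent polynomial are \<open>x\<^sub>1, \<dots>, x\<^sub>n\<close>, indexed by \<open>{1..n}\<close>.
  The ring structure on \<open>laurent\<close> is the convolution product of \<^theory>\<open>HOL-Library.Poly_Mapping\<close>.
\<close>

type_synonym expo = "nat \<Rightarrow>\<^sub>0 int"
type_synonym laurent = "expo \<Rightarrow>\<^sub>0 complex"

definition laurent_const :: "complex \<Rightarrow> laurent" where
  "laurent_const u = Poly_Mapping.single 0 u"

definition laurent_in :: "nat \<Rightarrow> laurent \<Rightarrow> bool" where
  "laurent_in n p \<longleftrightarrow> (\<forall>\<mu>\<in>Poly_Mapping.keys p. Poly_Mapping.keys \<mu> \<subseteq> {1..n})"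

text \<open>The value at a point \<open>x\<close>; meaningful when all \<open>x i\<close> that occur are nonzero.\<close>

definition laurent_eval :: "laurent \<Rightarrow> (nat \<Rightarrow> complex) \<Rightarrow> complex" where
  "laurent_eval p x =
     (\<Sum>\<mu>\<in>Poly_Mapping.keys p. Poly_Mapping.lookup p \<mu> *
        (\<Prod>i\<in>Poly_Mapping.keys \<mu>. x i powi Poly_Mapping.lookup \<mu> i))"


section \<open>The hyperoctahedral group action and the monomial symmetric functions\<close>

text \<open>
  The orbit of \<open>\<mu>\<close> (supported in \<open>{1..n}\<close>) under \<open>W\<^sub>n\<close>, acting on exponent vectors by
  permuting the entries and changing their signs. The signs outside \<open>{1..n}\<close> are irrelevant,
  since there \<open>\<mu>\<close> vanishes.
\<close>

definition W_orbit :: "nat \<Rightarrow> expo \<Rightarrow> expo set" where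
  "W_orbit n \<mu> = {\<nu>. \<exists>\<pi> \<epsilon>. \<pi> permutes {1..n} \<and> (\<forall>i. \<epsilon> i \<in> {1, -1}) \<and>
     (\<forall>i. Poly_Mapping.lookup \<nu> i = \<epsilon> i * Poly_Mapping.lookup \<mu> (\<pi> i))}"

definition W_invariant :: "nat \<Rightarrow> laurent \<Rightarrow> bool" where
  "W_invariant n p \<longleftrightarrow>
     (\<forall>\<mu>. \<forall>\<nu>\<in>W_orbit n \<mu>. Poly_Mapping.lookup p \<nu> = Poly_Mapping.lookup p \<mu>)"

text \<open>Partitions with at most \<open>n\<close> parts, as (nonnegative, weakly decreasing) exponent vectors.\<close>

definition is_partition :: "nat \<Rightarrow> expo \<Rightarrow> bool" where
  "is_partition n la \<longleftrightarrow> Poly_Mapping.keys la \<subseteq> {1..n} \<and>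
     (\<forall>i. 0 \<le> Poly_Mapping.lookup la i) \<and>
     (\<forall>i j. 1 \<le> i \<and> i \<le> j \<and> j \<le> n \<longrightarrow> Poly_Mapping.lookup la j \<le> Poly_Mapping.lookup la i)"

text \<open>
  Strict dominance order. The sizes of \<open>\<mu>\<close> and \<open>la\<close> are not required to be equal.
\<close>

definition dominance_less :: "nat \<Rightarrow> expo \<Rightarrow> expo \<Rightarrow> bool" where
  "dominance_less n \<mu> la \<longleftrightarrow> \<mu> \<noteq> la \<and>
     (\<forall>i\<in>{1..n}. (\<Sum>j=1..i. Poly_Mapping.lookup \<mu> j) \<le> (\<Sum>j=1..i. Poly_Mapping.lookup la j))"

text \<open>The column \<open>(1\<^sup>r)\<close>.\<close>

definition one_column :: "nat \<Rightarrow> expo" where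
  "one_column r = (\<Sum>i=1..r. Poly_Mapping.single i 1)"

definition monomial_sym :: "nat \<Rightarrow> expo \<Rightarrow> laurent" where
  "monomial_sym n la = (\<Sum>\<mu>\<in>W_orbit n la. Poly_Mapping.single \<mu> 1)"


section \<open>Koornwinder polynomials\<close>

text \<open>
  The value chosen for the square root \<open>(abcd/q)\<^bsup>1/2\<^esup>\<close> does not matter: changing its sign negates
  both the operator and its eigenvalues below.
\<close>

definition koornwinder_alpha :: "complex \<Rightarrow> complex \<Rightarrow> complex \<Rightarrow> complex \<Rightarrow> complex \<Rightarrow> complex" where
  "koornwinder_alpha a b c d q = csqrt (a * b * c * d / q)"

definition koornwinder_op ::
  "nat \<Rightarrow> complex \<Rightarrow> complex \<Rightarrow> complex \<Rightarrow> complex \<Rightarrow> complex \<Rightarrow> complex \<Rightarrow>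
   ((nat \<Rightarrow> complex) \<Rightarrow> complex) \<Rightarrow> (nat \<Rightarrow> complex) \<Rightarrow> complex" where
  "koornwinder_op n a b c d q t g x =
     (let \<alpha> = koornwinder_alpha a b c d q in
      (\<Sum>i=1..n.
         (1 - a * x i) * (1 - b * x i) * (1 - c * x i) * (1 - d * x i) /
           (\<alpha> * t ^ (n - 1) * (1 - (x i)\<^sup>2) * (1 - q * (x i)\<^sup>2)) *
         (\<Prod>j\<in>{1..n} - {i}.
            (1 - t * x i * x j) * (1 - t * x i / x j) /
              ((1 - x i * x j) * (1 - x i / x j))) *
         (g (x(i := q * x i)) - g x)) +
      (\<Sum>i=1..n.
         (1 - a / x i) * (1 - b / x i) * (1 - c / x i) * (1 - d / x i) /
           (\<alpha> * t ^ (n - 1) * (1 - 1 / (x i)\<^sup>2) * (1 - q / (x i)\<^sup>2)) *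
         (\<Prod>j\<in>{1..n} - {i}.
            (1 - t * x j / x i) * (1 - t / (x i * x j)) /
              ((1 - x j / x i) * (1 - 1 / (x i * x j)))) *
         (g (x(i := inverse q * x i)) - g x)))"

text \<open>
  The points of the torus at which no denominator of the operator vanishes. They form a dense
  open set, so an identity of rational functions is the same as an identity at all these points.
\<close>

definition koornwinder_regular :: "nat \<Rightarrow> complex \<Rightarrow> (nat \<Rightarrow> complex) \<Rightarrow> bool" where
  "koornwinder_regular n q x \<longleftrightarrow>
     (\<forall>i\<in>{1..n}. x i \<noteq> 0 \<and> (x i)\<^sup>2 \<noteq> 1 \<and> q * (x i)\<^sup>2 \<noteq> 1 \<and> (x i)\<^sup>2 \<noteq> q) \<and>
     (\<forall>i\<in>{1..n}. \<forall>j\<in>{1..n}. i \<noteq> j \<longrightarrow> x i * x j \<noteq> 1 \<and> x i \<noteq> x j)"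

definition koornwinder_eigenvalue ::
  "nat \<Rightarrow> expo \<Rightarrow> complex \<Rightarrow> complex \<Rightarrow> complex \<Rightarrow> complex \<Rightarrow> complex \<Rightarrow> complex \<Rightarrow> complex" where
  "koornwinder_eigenvalue n la a b c d q t =
     (let \<alpha> = koornwinder_alpha a b c d q in
      (\<Sum>j=1..n.
         \<alpha> * t powi (int n - int j) * q powi (Poly_Mapping.lookup la j)
         + inverse \<alpha> * t powi (- int n + int j) * q powi (- Poly_Mapping.lookup la j)
         - \<alpha> * t powi (int n - int j)
         - inverse \<alpha> * t powi (- int n + int j)))"

definition is_koornwinder ::
  "nat \<Rightarrow> expo \<Rightarrow> complex \<Rightarrow> complex \<Rightarrow> complex \<Rightarrow> complex \<Rightarrow> complex \<Rightarrow> complex \<Rightarrow> laurent \<Rightarrow> bool" where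
  "is_koornwinder n la a b c d q t P \<longleftrightarrow>
     laurent_in n P \<and> W_invariant n P \<and>
     (\<exists>A u. finite A \<and> A \<subseteq> {\<mu>. is_partition n \<mu> \<and> dominance_less n \<mu> la} \<and>
        P = monomial_sym n la + (\<Sum>\<mu>\<in>A. laurent_const (u \<mu>) * monomial_sym n \<mu>)) \<and>
     (\<forall>x. koornwinder_regular n q x \<longrightarrow>
        koornwinder_op n a b c d q t (laurent_eval P) x =
        koornwinder_eigenvalue n la a b c d q t * laurent_eval P x)"

definition koornwinder ::
  "nat \<Rightarrow> expo \<Rightarrow> complex \<Rightarrow> complex \<Rightarrow> complex \<Rightarrow> complex \<Rightarrow> complex \<Rightarrow> complex \<Rightarrow> laurent" where
  "koornwinder n la a b c d q t = (THE P. is_koornwinder n la a b c d q t P)"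

text \<open>
  Macdonald polynomials of type \<open>(C\<^sub>n, C\<^sub>n)\<close> and type \<open>C\<^sub>n\<close> Schur polynomials. The operator
  and the eigenvalues are symmetric in the four parameters, so the choice of the square
  roots is immaterial.
\<close>

definition macdonald_CC :: "nat \<Rightarrow> expo \<Rightarrow> complex \<Rightarrow> complex \<Rightarrow> complex \<Rightarrow> laurent" where
  "macdonald_CC n la b q t =
     koornwinder n la (csqrt b) (- csqrt b) (csqrt q * csqrt b) (- (csqrt q * csqrt b)) q t"

definition schur_C :: "nat \<Rightarrow> expo \<Rightarrow> complex \<Rightarrow> laurent" where
  "schur_C n la q = macdonald_CC n la q q q"

definition column_f :: "complex \<Rightarrow> complex \<Rightarrow> complex \<Rightarrow> complex \<Rightarrow> complex" where
  "column_f a c t s =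
     (1 - 1 / s) * (1 - t\<^sup>2 / (s * a\<^sup>2 * c\<^sup>2)) * (1 + t / (s * a\<^sup>2)) * (1 + t / (s * c\<^sup>2)) /
       ((1 - t / (s\<^sup>2 * a\<^sup>2 * c\<^sup>2)) * (1 - t ^ 3 / (s\<^sup>2 * a\<^sup>2 * c\<^sup>2)))"

end

theory Submission
  imports Defs "HOL-Computational_Algebra.Polynomial"
begin

text \<open>
  At \<open>b = t = q\<close> the first coefficient of the operator collapses to
  \<open>(1 - q\<^sup>2 x\<^sup>2) / (1 - x\<^sup>2)\<close> times the product over pairs. Write \<open>y\<^sub>i = x\<^sub>i + 1/x\<^sub>i\<close> and
  \<open>G\<^sub>u(x) = (1 - u\<^sup>2) \<Prod>\<^sub>i (1 + u y\<^sub>i + u\<^sup>2)\<close>. Applying the operator to \<open>G\<^sub>u\<close> produces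
  residues of a rational function with poles at \<open>x\<^sub>i\<close>, \<open>1/x\<^sub>i\<close>, \<open>0\<close>, \<open>-u\<close>, \<open>-1/u\<close>, so the
  residue theorem (in the form of the leading coefficient of a Lagrange interpolant) shows that
  up to a constant it maps \<open>G\<^sub>u\<close> to
  \<open>(1 + q\<^bsup>2n+2\<^esup>) G\<^sub>u - G\<^bsub>qu\<^esub> - q\<^bsup>2n+2\<^esup> G\<^bsub>u/q\<^esub>\<close>.
  Hence the coefficients of \<open>G\<^sub>u\<close> in \<open>u\<close> are eigenfunctions, and expanding them in the elementary
  symmetric functions of the \<open>y\<^sub>i\<close>, which are the one-column monomial symmetric functions, gives
  the claimed coefficients. Uniqueness holds because only columns lie below a column, the operator
  is triangular on them, and their eigenvalues differ for \<open>0 < \<bar>q\<bar> < 1\<close>.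
\<close>

section \<open>Lagrange interpolation\<close>

lemma sum_lagrange_coeff:
  fixes P :: "'a::field poly"
  assumes fin: "finite S" and deg: "degree P < card S"
  shows "(\<Sum>p\<in>S. poly P p / (\<Prod>p'\<in>S-{p}. p - p')) = coeff P (card S - 1)"
proof -
  define w where "w = (\<lambda>p. \<Prod>p'\<in>S-{p}. p - p')"
  define B where "B = (\<lambda>p. \<Prod>p'\<in>S-{p}. [:-p',1:])"
  define L where "L = (\<Sum>p\<in>S. smult (poly P p / w p) (B p))"
  have degB: "degree (B p) = card S - 1" if "p \<in> S" for p
    using that fin unfolding B_def by (subst degree_prod_eq_sum_degree) auto
  have coeffB: "coeff (B p) (card S - 1) = 1" if "p \<in> S" for p
  proof -
    have "lead_coeff (B p) = 1" unfolding B_def lead_coeff_prod by simp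
    then show ?thesis using degB[OF that] by simp
  qed
  have polyB: "poly (B p) z = (if z = p then w p else 0)" if "p \<in> S" "z \<in> S" for p z
  proof (cases "z = p")
    case True
    then show ?thesis by (simp add: B_def w_def poly_prod)
  next
    case False
    then show ?thesis using that fin unfolding B_def poly_prod
      by (auto intro!: prod_zero bexI[of _ z])
  qed
  have "L = P"
  proof (rule poly_eqI_degree[of S])
    fix z assume z: "z \<in> S"
    have "w z \<noteq> 0" using fin by (auto simp: w_def)
    have "poly L z = (\<Sum>p\<in>S. if p = z then poly P p else 0)"
      unfolding L_def poly_sum poly_smult
    proof (rule sum.cong)
      fix p assume "p \<in> S"
      with polyB[OF this z] \<open>w z \<noteq> 0\<close>
      show "poly P p / w p * poly (B p) z = (if p = z then poly P p else 0)" by auto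
    qed simp
    also have "\<dots> = poly P z" using fin z by simp
    finally show "poly L z = poly P z" .
  next
    have "degree L \<le> card S - 1" unfolding L_def
      by (rule degree_sum_le) (simp_all add: fin degB)
    then show "degree L < card S" using deg by linarith
  qed (use deg in auto)
  moreover have "coeff L (card S - 1) = (\<Sum>p\<in>S. poly P p / w p)"
    unfolding L_def coeff_sum by (intro sum.cong) (simp_all add: coeffB[unfolded One_nat_def])
  ultimately show ?thesis by (simp add: w_def)
qed

definition nodes :: "nat \<Rightarrow> (nat \<Rightarrow> complex) \<Rightarrow> complex set" where
  "nodes n x = x ` {1..n} \<union> (\<lambda>i. inverse (x i)) ` {1..n}"

definition nodes_regular :: "nat \<Rightarrow> (nat \<Rightarrow> complex) \<Rightarrow> bool" where
  "nodes_regular n x \<longleftrightarrow> (\<forall>i\<in>{1..n}. x i \<noteq> 0) \<and> inj_on x {1..n} \<and>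
     (\<forall>i\<in>{1..n}. \<forall>j\<in>{1..n}. x i * x j \<noteq> 1)"

lemma nodes_inverse: "nodes n (\<lambda>i. inverse (x i)) = nodes n x"
  by (auto simp: nodes_def)

lemma nodes_inj:
  assumes "nodes_regular n x" shows "inj_on (\<lambda>i. inverse (x i)) {1..n}"
proof (rule inj_onI)
  fix i j assume ij: "i \<in> {1..n}" "j \<in> {1..n}" "inverse (x i) = inverse (x j)"
  then have "x i = x j" by simp
  with ij assms show "i = j" unfolding nodes_regular_def inj_on_def by blast
qed

lemma nodes_regular_inverse:
  assumes "nodes_regular n x" shows "nodes_regular n (\<lambda>i. inverse (x i))"
  unfolding nodes_regular_def
proof (intro conjI ballI)
  show "inj_on (\<lambda>i. inverse (x i)) {1..n}"
    by (rule nodes_inj[OF assms])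
next
  fix i j assume "i \<in> {1..n}" "j \<in> {1..n}"
  then have "x i * x j \<noteq> 1" using assms by (simp add: nodes_regular_def)
  then show "inverse (x i) * inverse (x j) \<noteq> 1"
    by (metis inverse_eq_1_iff inverse_mult_distrib)
qed (use assms in \<open>simp add: nodes_regular_def\<close>)

lemma finite_nodes [simp]: "finite (nodes n x)"
  by (simp add: nodes_def)

lemma nodes_disjoint:
  assumes "nodes_regular n x"
  shows "x ` {1..n} \<inter> (\<lambda>i. inverse (x i)) ` {1..n} = {}"
proof (rule ccontr)
  assume "\<not> ?thesis"
  then obtain i j where ij: "i \<in> {1..n}" "j \<in> {1..n}" "x i = inverse (x j)" by blast
  then have "x i * x j = 1" using assms by (simp add: nodes_regular_def)
  then show False using assms ij unfolding nodes_regular_def by blast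
qed

lemma sum_nodes:
  assumes "nodes_regular n x"
  shows "(\<Sum>p\<in>nodes n x. f p) = (\<Sum>i=1..n. f (x i)) + (\<Sum>i=1..n. f (inverse (x i)))"
proof -
  have "inj_on (\<lambda>i. inverse (x i)) {1..n}" by (rule nodes_inj[OF assms])
  then show ?thesis using assms nodes_disjoint[OF assms]
    by (simp add: nodes_def sum.union_disjoint sum.reindex nodes_regular_def)
qed

lemma prod_nodes:
  assumes "nodes_regular n x"
  shows "(\<Prod>p\<in>nodes n x. f p) = (\<Prod>i=1..n. f (x i) * f (inverse (x i)))"
proof -
  have "inj_on (\<lambda>i. inverse (x i)) {1..n}" by (rule nodes_inj[OF assms])
  then show ?thesis using assms nodes_disjoint[OF assms]
    by (simp add: nodes_def prod.union_disjoint prod.reindex nodes_regular_def prod.distrib)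
qed

lemma prod_nodes_remove:
  assumes reg: "nodes_regular n x" and i: "i \<in> {1..n}"
  shows "(\<Prod>p\<in>nodes n x - {x i}. f p) =
    f (inverse (x i)) * (\<Prod>j\<in>{1..n}-{i}. f (x j) * f (inverse (x j)))"
proof -
  have inj: "inj_on x {1..n}" "inj_on (\<lambda>i. inverse (x i)) {1..n}"
    using reg nodes_inj by (auto simp: nodes_regular_def)
  have "nodes n x - {x i} = x ` ({1..n} - {i}) \<union> (\<lambda>i. inverse (x i)) ` {1..n}"
    using nodes_disjoint[OF reg] i inj_onD[OF inj(1)] unfolding nodes_def by blast
  moreover have "x ` ({1..n} - {i}) \<inter> (\<lambda>i. inverse (x i)) ` {1..n} = {}"
    using nodes_disjoint[OF reg] by blast
  moreover have "inj_on x ({1..n} - {i})" using inj(1) by (rule inj_on_subset) auto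
  moreover have "(\<Prod>j=1..n. f (inverse (x j))) =
      f (inverse (x i)) * (\<Prod>j\<in>{1..n}-{i}. f (inverse (x j)))"
    using i by (intro prod.remove) auto
  ultimately show ?thesis using inj(2)
    by (simp add: prod.union_disjoint prod.reindex prod.distrib mult_ac)
qed

lemma card_nodes:
  assumes "nodes_regular n x" shows "card (nodes n x) = 2 * n"
proof -
  have "inj_on (\<lambda>i. inverse (x i)) {1..n}" by (rule nodes_inj[OF assms])
  then show ?thesis using assms nodes_disjoint[OF assms]
    by (simp add: nodes_def card_Un_disjoint card_image nodes_regular_def)
qed

section \<open>The generating function of the symplectic characters\<close>

definition plus_inverse :: "complex \<Rightarrow> complex" where
  "plus_inverse z = z + inverse z"

definition pair_poly :: "nat \<Rightarrow> (nat \<Rightarrow> complex) \<Rightarrow> complex poly" where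
  "pair_poly n x = (\<Prod>i=1..n. [:1, plus_inverse (x i), 1:])"

definition symp_poly :: "nat \<Rightarrow> (nat \<Rightarrow> complex) \<Rightarrow> complex poly" where
  "symp_poly n x = [:1, 0, -1:] * pair_poly n x"

lemma quad_factor:
  "z \<noteq> 0 \<Longrightarrow> poly [:1, plus_inverse z, 1:] u = (1 + u * z) * (1 + u * inverse z)"
  by (simp add: plus_inverse_def field_simps)

lemma poly_pair_poly:
  assumes "\<forall>i\<in>{1..n}. x i \<noteq> 0"
  shows "poly (pair_poly n x) u = (\<Prod>i=1..n. (1 + u * x i) * (1 + u * inverse (x i)))"
  unfolding pair_poly_def poly_prod using assms quad_factor by (intro prod.cong) auto

lemma pair_poly_inverse: "pair_poly n (\<lambda>i. inverse (x i)) = pair_poly n x"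
  by (simp add: pair_poly_def plus_inverse_def add.commute)

lemma quad_monic_factor:
  "z \<noteq> 0 \<Longrightarrow> (p - z) * (p - inverse z) = (1 - p * z) * (1 - p * inverse z)" for z :: complex
  by (simp add: field_simps)

lemma pair_poly_nz: "pair_poly n x \<noteq> 0"
  by (simp add: pair_poly_def)

lemma coeff_pair_poly:
  "degree (pair_poly n x) = 2 * n" "coeff (pair_poly n x) (2 * n) = 1"
proof -
  show *: "degree (pair_poly n x) = 2 * n"
    unfolding pair_poly_def by (subst degree_prod_eq_sum_degree) auto
  have "lead_coeff (pair_poly n x) = 1" unfolding pair_poly_def lead_coeff_prod by simp
  with * show "coeff (pair_poly n x) (2 * n) = 1" by simp
qed

text \<open>
  With \<open>M(z) = \<Prod>\<^sub>i (z - x\<^sub>i) (z - 1/x\<^sub>i)\<close>, which is the value of \<open>pair_poly\<close> at \<open>-z\<close>, the following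
  numerator is \<open>(1 - q\<^sup>2 z\<^sup>2) M(q z)\<close>.
\<close>

definition num_poly :: "nat \<Rightarrow> complex \<Rightarrow> (nat \<Rightarrow> complex) \<Rightarrow> complex poly" where
  "num_poly n q x = [:1, 0, -q\<^sup>2:] * pcompose (pair_poly n x) [:0, -q:]"

lemma poly_num_poly:
  "poly (num_poly n q x) z = (1 - q\<^sup>2 * z\<^sup>2) * poly (pair_poly n x) (- q * z)"
  by (simp add: num_poly_def poly_pcompose power2_eq_square algebra_simps)

lemma coeff_num_poly:
  assumes "q \<noteq> 0"
  shows "degree (num_poly n q x) = 2 * n + 2"
    "coeff (num_poly n q x) (2 * n + 2) = - (q ^ (2 * n + 2))"
proof -
  have d: "degree (pcompose (pair_poly n x) [:0, -q:]) = 2 * n"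
    using assms by (simp add: degree_pcompose coeff_pair_poly)
  have c: "coeff (pcompose (pair_poly n x) [:0, -q:]) (2 * n) = q ^ (2 * n)"
    by (simp add: coeff_pcompose_linear coeff_pair_poly)
  then have nz: "pcompose (pair_poly n x) [:0, -q:] \<noteq> 0" using assms by auto
  show deg: "degree (num_poly n q x) = 2 * n + 2"
    unfolding num_poly_def using assms nz d by (subst degree_mult_eq) auto
  have "lead_coeff (num_poly n q x) = - (q\<^sup>2) * q ^ (2 * n)"
    unfolding num_poly_def lead_coeff_mult d c using assms by simp
  then show "coeff (num_poly n q x) (2 * n + 2) = - (q ^ (2 * n + 2))"
    unfolding deg by (simp add: power_add power2_eq_square)
qed

lemma poly_pair_poly_reciprocal:
  assumes "u \<noteq> 0"
  shows "poly (pair_poly n x) (inverse u) = poly (pair_poly n x) u / u ^ (2 * n)"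
proof -
  have "poly (pair_poly n x) (inverse u) = (\<Prod>i=1..n. poly [:1, plus_inverse (x i), 1:] u / u\<^sup>2)"
    unfolding pair_poly_def poly_prod
    using assms by (intro prod.cong) (simp_all add: field_simps power2_eq_square)
  also have "\<dots> = poly (pair_poly n x) u / u ^ (2 * n)"
    by (simp add: prod_dividef pair_poly_def poly_prod power_mult)
  finally show ?thesis .
qed

lemma prod_nodes_diff:
  assumes "nodes_regular n x"
  shows "(\<Prod>p\<in>nodes n x. z - p) = poly (pair_poly n x) (- z)"
  unfolding prod_nodes[OF assms] using assms
  by (subst poly_pair_poly) (auto simp: nodes_regular_def quad_monic_factor intro!: prod.cong)

definition ext_nodes :: "nat \<Rightarrow> (nat \<Rightarrow> complex) \<Rightarrow> complex \<Rightarrow> complex set" where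
  "ext_nodes n x u = {0, - u, - inverse u} \<union> nodes n x"

definition generic_param :: "nat \<Rightarrow> (nat \<Rightarrow> complex) \<Rightarrow> complex \<Rightarrow> bool" where
  "generic_param n x u \<longleftrightarrow> u \<noteq> 0 \<and> u\<^sup>2 \<noteq> 1 \<and> poly (pair_poly n x) u \<noteq> 0"

lemma generic_param_factor_nz:
  assumes "nodes_regular n x" "generic_param n x u" "i \<in> {1..n}"
  shows "1 + u * x i \<noteq> 0" "x i + u \<noteq> 0"
proof -
  have "x i \<noteq> 0" using assms by (simp add: nodes_regular_def)
  moreover have "(1 + u * x i) * (1 + u * inverse (x i)) \<noteq> 0"
    using assms poly_pair_poly[of n x u] by (auto simp: generic_param_def nodes_regular_def)
  moreover have "x i + u = x i * (1 + u * inverse (x i))"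
    using \<open>x i \<noteq> 0\<close> by (simp add: field_simps)
  ultimately show "1 + u * x i \<noteq> 0" "x i + u \<noteq> 0" by auto
qed

lemma generic_param_not_node:
  assumes "nodes_regular n x" "generic_param n x u" "z \<in> {0, - u, - inverse u}"
  shows "z \<notin> nodes n x"
proof -
  have "u \<noteq> 0" using assms by (simp add: generic_param_def)
  have "poly (pair_poly n x) 0 = 1" by (simp add: pair_poly_def poly_prod)
  then have "poly (pair_poly n x) (- z) \<noteq> 0"
    using assms(2,3) poly_pair_poly_reciprocal[OF \<open>u \<noteq> 0\<close>, of n x]
    by (auto simp: generic_param_def)
  then have "(\<Prod>p\<in>nodes n x. z - p) \<noteq> 0" using prod_nodes_diff[OF assms(1)] by simp
  then show ?thesis by auto
qed

lemma generic_param_distinct: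
  assumes "generic_param n x u"
  shows "- u \<noteq> - inverse u" "u \<noteq> 0" "u \<noteq> inverse u" "inverse u \<noteq> u"
  using assms by (auto simp: generic_param_def power2_eq_square field_simps)

lemma ext_nodes_inverse: "ext_nodes n (\<lambda>i. inverse (x i)) u = ext_nodes n x u"
  by (simp add: ext_nodes_def nodes_inverse)

lemma prod_ext_nodes_remove:
  assumes reg: "nodes_regular n x" and gen: "generic_param n x u" and z: "z \<in> nodes n x"
  shows "(\<Prod>p\<in>ext_nodes n x u - {z}. z - p) =
    z * (z + u) * (z + inverse u) * (\<Prod>p\<in>nodes n x - {z}. z - p)"
proof -
  have *: "z \<notin> {0, - u, - inverse u}" using generic_param_not_node[OF reg gen] z by blast
  then have "ext_nodes n x u - {z} = {0, - u, - inverse u} \<union> (nodes n x - {z})"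
    by (auto simp: ext_nodes_def)
  moreover have "{0, - u, - inverse u} \<inter> (nodes n x - {z}) = {}"
    using generic_param_not_node[OF reg gen] by blast
  ultimately show ?thesis using generic_param_distinct[OF gen]
    by (simp add: prod.union_disjoint)
qed

lemma card_ext_nodes:
  assumes reg: "nodes_regular n x" and gen: "generic_param n x u"
  shows "card (ext_nodes n x u) = 2 * n + 3" "finite (ext_nodes n x u)"
proof -
  have "{0, - u, - inverse u} \<inter> nodes n x = {}"
    using generic_param_not_node[OF reg gen] by blast
  then have "card (ext_nodes n x u) = card {0, - u, - inverse u} + card (nodes n x)"
    unfolding ext_nodes_def by (intro card_Un_disjoint) auto
  then show "card (ext_nodes n x u) = 2 * n + 3" 
    using generic_param_distinct[OF gen] card_nodes[OF reg] by simp
qed (simp add: ext_nodes_def)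

lemma residue_sum:
  assumes reg: "nodes_regular n x" and gen: "generic_param n x u" and q: "q \<noteq> 0"
  defines "F \<equiv> poly (pair_poly n x)"
  shows "(\<Sum>z\<in>nodes n x. poly (num_poly n q x) z / (\<Prod>p\<in>ext_nodes n x u - {z}. z - p)) =
    - (q ^ (2 * n + 2)) - 1 + (1 - q\<^sup>2 * u\<^sup>2) * F (q * u) / ((1 - u\<^sup>2) * F u)
      - (u\<^sup>2 - q\<^sup>2) * q ^ (2 * n) * F (u / q) / ((1 - u\<^sup>2) * F u)"
proof -
  let ?S = "ext_nodes n x u" and ?P = "poly (num_poly n q x)"
  let ?w = "\<lambda>z. \<Prod>p\<in>?S - {z}. z - p"
  note dist = generic_param_distinct[OF gen]
  have nz: "u \<noteq> 0" "u\<^sup>2 \<noteq> 1" "F u \<noteq> 0" using gen by (auto simp: generic_param_def F_def)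
  have disj: "{0, - u, - inverse u} \<inter> nodes n x = {}"
    using generic_param_not_node[OF reg gen] by blast
  have w: "?w z = (\<Prod>p\<in>{0, - u, - inverse u} - {z}. z - p) * F (- z)"
    if "z \<in> {0, - u, - inverse u}" for z
  proof -
    have "?S - {z} = ({0, - u, - inverse u} - {z}) \<union> nodes n x"
      using that disj by (auto simp: ext_nodes_def)
    moreover have "({0, - u, - inverse u} - {z}) \<inter> nodes n x = {}" using disj by blast
    ultimately have "?w z = (\<Prod>p\<in>{0, - u, - inverse u} - {z}. z - p) * (\<Prod>p\<in>nodes n x. z - p)"
      by (simp add: prod.union_disjoint)
    then show ?thesis by (simp add: prod_nodes_diff[OF reg] F_def)
  qed
  have F0: "F 0 = 1" by (simp add: F_def pair_poly_def poly_prod)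
  have r0: "?P 0 / ?w 0 = 1"
  proof -
    have "{0, - u, - inverse u} - {0} = {- u, - inverse u}" using dist by auto
    then have "?w 0 = 1" using dist F0 by (subst w) auto
    then show ?thesis using F0 by (simp add: poly_num_poly F_def)
  qed
  have r1: "?P (- u) / ?w (- u) = - ((1 - q\<^sup>2 * u\<^sup>2) * F (q * u) / ((1 - u\<^sup>2) * F u))"
  proof -
    have "{0, - u, - inverse u} - {- u} = {0, - inverse u}" using dist by auto
    then have "?w (- u) = (- u) * (- u + inverse u) * F u" using dist by (subst w) auto
    also have "\<dots> = - ((1 - u\<^sup>2) * F u)" using nz by (simp add: field_simps power2_eq_square)
    finally have "?w (- u) = - ((1 - u\<^sup>2) * F u)" .
    then show ?thesis by (simp add: poly_num_poly F_def)
  qed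
  have r2: "?P (- inverse u) / ?w (- inverse u) =
      (u\<^sup>2 - q\<^sup>2) * q ^ (2 * n) * F (u / q) / ((1 - u\<^sup>2) * F u)"
  proof -
    have "{0, - u, - inverse u} - {- inverse u} = {0, - u}" using dist by auto
    then have "?w (- inverse u) = (- inverse u) * (- inverse u + u) * F (inverse u)"
      using dist by (subst w) auto
    also have "F (inverse u) = F u / u ^ (2 * n)"
      unfolding F_def by (rule poly_pair_poly_reciprocal[OF \<open>u \<noteq> 0\<close>])
    also have "(- inverse u) * (- inverse u + u) * (F u / u ^ (2 * n)) =
        (1 - u\<^sup>2) * F u / (u\<^sup>2 * u ^ (2 * n))"
      using nz by (simp add: field_simps power2_eq_square)
    finally have 1: "?w (- inverse u) = (1 - u\<^sup>2) * F u / (u\<^sup>2 * u ^ (2 * n))" .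
    have "q * inverse u = inverse (u / q)" using nz q by (simp add: field_simps)
    then have "F (q * inverse u) = F (u / q) * q ^ (2 * n) / u ^ (2 * n)"
      using nz q poly_pair_poly_reciprocal[of "u / q" n x] by (simp add: F_def power_divide)
    then have 2: "?P (- inverse u) = (u\<^sup>2 - q\<^sup>2) / u\<^sup>2 * (F (u / q) * q ^ (2 * n) / u ^ (2 * n))"
      using nz by (simp add: poly_num_poly F_def field_simps)
    have "a / c * (b * d / e) / (w / (c * e)) = a * d * b / w"
      if "c \<noteq> 0" "e \<noteq> 0" for a b c d e w :: complex
      using that by (cases "w = 0") (simp_all add: field_simps)
    then show ?thesis unfolding 1 2 using nz by simp
  qed
  have "(\<Sum>z\<in>?S. ?P z / ?w z) = coeff (num_poly n q x) (card ?S - 1)"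
    using card_ext_nodes[OF reg gen] q coeff_num_poly(1)[OF q]
    by (intro sum_lagrange_coeff) simp_all
  also have "card ?S - 1 = 2 * n + 2" using card_ext_nodes[OF reg gen] by simp
  finally have "(\<Sum>z\<in>?S. ?P z / ?w z) = - (q ^ (2 * n + 2))"
    unfolding coeff_num_poly(2)[OF q] .
  moreover have "(\<Sum>z\<in>?S. ?P z / ?w z) =
      (\<Sum>z\<in>{0, - u, - inverse u}. ?P z / ?w z) + (\<Sum>z\<in>nodes n x. ?P z / ?w z)"
    by (subst sum.union_disjoint[symmetric]) (use disj in \<open>auto simp: ext_nodes_def\<close>)
  moreover have "(\<Sum>z\<in>{0, - u, - inverse u}. ?P z / ?w z) =
      ?P 0 / ?w 0 + ?P (- u) / ?w (- u) + ?P (- inverse u) / ?w (- inverse u)"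
    using dist by simp
  ultimately show ?thesis unfolding r0 r1 r2 by (simp add: algebra_simps)
qed

definition schur_coeff :: "nat \<Rightarrow> complex \<Rightarrow> (nat \<Rightarrow> complex) \<Rightarrow> nat \<Rightarrow> complex" where
  "schur_coeff n q x i = (1 - q\<^sup>2 * (x i)\<^sup>2) / (1 - (x i)\<^sup>2) *
     (\<Prod>j\<in>{1..n} - {i}. (1 - q * x i * x j) * (1 - q * x i / x j) /
        ((1 - x i * x j) * (1 - x i / x j)))"

lemma schur_coeff_residue:
  assumes reg: "nodes_regular n x" and gen: "generic_param n x u" and q: "q \<noteq> 0" and i: "i \<in> {1..n}"
  defines "F \<equiv> \<lambda>x. poly (pair_poly n x) u"
  shows "schur_coeff n q x i * (F (x(i := q * x i)) - F x) =
    - (F x / q) * (poly (num_poly n q x) (x i) / (\<Prod>p\<in>ext_nodes n x u - {x i}. x i - p))"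
proof -
  define I where "I = {1..n} - {i}"
  define p where "p = x i"
  define R where "R = (\<Prod>j\<in>I. (1 + u * x j) * (1 + u * inverse (x j)))"
  define N where "N = (\<Prod>j\<in>I. (1 - q * p * x j) * (1 - q * p / x j))"
  define D where "D = (\<Prod>j\<in>I. (1 - p * x j) * (1 - p / x j))"
  have xnz: "x j \<noteq> 0" if "j \<in> {1..n}" for j using reg that by (simp add: nodes_regular_def)
  have ne: "\<forall>j\<in>{1..n}. x j \<noteq> 0" using xnz by blast
  have pnz: "p \<noteq> 0" using xnz i by (simp add: p_def)
  have pp: "1 - p\<^sup>2 \<noteq> 0"
    using reg i by (auto simp: nodes_regular_def p_def power2_eq_square)
  have fac: "1 + u * p \<noteq> 0" "p + u \<noteq> 0"
    using generic_param_factor_nz[OF reg gen i] by (auto simp: p_def)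
  have unz: "u \<noteq> 0" using gen by (simp add: generic_param_def)
  have split: "(\<Prod>j=1..n. f j) = f i * (\<Prod>j\<in>I. f j)" for f :: "nat \<Rightarrow> complex"
    unfolding I_def using i by (intro prod.remove) auto
  have Dnz: "D \<noteq> 0" unfolding D_def
  proof (subst prod_zero_iff, use I_def in simp, safe)
    fix j assume j: "j \<in> I" "(1 - p * x j) * (1 - p / x j) = 0"
    have "x i * x j \<noteq> 1" using reg i j(1) by (auto simp: nodes_regular_def I_def)
    moreover have "x i \<noteq> x j"
      using reg i j(1) unfolding nodes_regular_def I_def inj_on_def by blast
    ultimately show False using j xnz[of j] by (auto simp: p_def I_def)
  qed
  have Fx: "F x = (1 + u * p) * (1 + u * inverse p) * R"
    unfolding F_def poly_pair_poly[OF ne] split R_def p_def by (rule refl)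
  have Fs: "F (x(i := q * x i)) = (1 + u * (q * p)) * (1 + u * inverse (q * p)) * R"
  proof -
    have ne': "\<forall>j\<in>{1..n}. (x(i := q * x i)) j \<noteq> 0" using xnz q by simp
    have "F (x(i := q * x i)) = (1 + u * (q * p)) * (1 + u * inverse (q * p)) *
        (\<Prod>j\<in>I. (1 + u * (x(i := q * x i)) j) * (1 + u * inverse ((x(i := q * x i)) j)))"
      unfolding F_def poly_pair_poly[OF ne'] split p_def by simp
    also have "(\<Prod>j\<in>I. (1 + u * (x(i := q * x i)) j) * (1 + u * inverse ((x(i := q * x i)) j))) = R"
      unfolding R_def by (intro prod.cong) (auto simp: I_def)
    finally show ?thesis .
  qed
  have P: "poly (num_poly n q x) p = (1 - q\<^sup>2 * p\<^sup>2) * ((1 - q * p\<^sup>2) * (1 - q) * N)"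
  proof -
    have "poly (pair_poly n x) (- q * p) = (1 - q * p * x i) * (1 - q * p * inverse (x i)) * N"
      unfolding poly_pair_poly[OF ne] split N_def by (simp add: divide_inverse)
    also have "\<dots> = (1 - q * p\<^sup>2) * (1 - q) * N"
      unfolding p_def[symmetric] using pnz by (simp add: power2_eq_square mult.assoc)
    finally show ?thesis by (simp add: poly_num_poly)
  qed
  have W: "(\<Prod>p'\<in>ext_nodes n x u - {p}. p - p') =
      p * (p + u) * (p + inverse u) * ((p - inverse p) * D)"
  proof -
    have "p \<in> nodes n x" using i by (simp add: nodes_def p_def)
    then have "(\<Prod>p'\<in>ext_nodes n x u - {p}. p - p') =
        p * (p + u) * (p + inverse u) * (\<Prod>p'\<in>nodes n x - {p}. p - p')"
      by (rule prod_ext_nodes_remove[OF reg gen])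
    also have "(\<Prod>p'\<in>nodes n x - {p}. p - p') =
        (p - inverse p) * (\<Prod>j\<in>I. (p - x j) * (p - inverse (x j)))"
      unfolding p_def I_def by (rule prod_nodes_remove[OF reg i])
    also have "(\<Prod>j\<in>I. (p - x j) * (p - inverse (x j))) = D"
      unfolding D_def using xnz
      by (intro prod.cong) (auto simp: quad_monic_factor I_def divide_inverse)
    finally show ?thesis .
  qed
  have K: "schur_coeff n q x i = (1 - q\<^sup>2 * p\<^sup>2) / (1 - p\<^sup>2) * (N / D)"
    unfolding schur_coeff_def N_def D_def p_def I_def by (simp add: prod_dividef)
  have diff: "(1 + u * (q * p)) * (1 + u * inverse (q * p)) - (1 + u * p) * (1 + u * inverse p) =
      u * (1 - q) * (1 - q * p\<^sup>2) / (q * p)"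
    using pnz q by (simp add: field_simps power2_eq_square)
  have "schur_coeff n q x i * (F (x(i := q * x i)) - F x) =
      (1 - q\<^sup>2 * p\<^sup>2) / (1 - p\<^sup>2) * (N / D) * (u * (1 - q) * (1 - q * p\<^sup>2) / (q * p) * R)"
    unfolding K Fs Fx diff[symmetric] by (simp add: algebra_simps)
  also have "\<dots> = (1 - q\<^sup>2 * p\<^sup>2) * ((1 - q * p\<^sup>2) * (1 - q) * N) * R / (q * D) *
      (u / (p * (1 - p\<^sup>2)))"
    by (simp add: mult_ac)
  also have "u / (p * (1 - p\<^sup>2)) = - ((1 + u * p) * (1 + u * inverse p)) /
      (p * (p + u) * (p + inverse u) * (p - inverse p))"
  proof -
    have 1: "p + inverse u = (1 + u * p) / u" using unz by (simp add: field_simps)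
    have 2: "p - inverse p = - (1 - p\<^sup>2) / p"
      using pnz by (simp add: field_simps power2_eq_square)
    have 3: "1 + u * inverse p = (p + u) / p" using pnz by (simp add: field_simps)
    have "u / (p * e) = - (A * (B / p)) / (p * B * (A / u) * (- e / p))"
      if "e \<noteq> 0" "A \<noteq> 0" "B \<noteq> 0" for e A B
      using that pnz unz by simp
    then show ?thesis unfolding 1 2 3 using fac pp by blast
  qed
  also have "(1 - q\<^sup>2 * p\<^sup>2) * ((1 - q * p\<^sup>2) * (1 - q) * N) * R / (q * D) *
      (- ((1 + u * p) * (1 + u * inverse p)) / (p * (p + u) * (p + inverse u) * (p - inverse p)))
    = - (F x / q) * (poly (num_poly n q x) p / (\<Prod>p'\<in>ext_nodes n x u - {p}. p - p'))"
    unfolding P W Fx by (simp add: mult_ac)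
  finally show ?thesis unfolding p_def .
qed

definition schur_op :: "nat \<Rightarrow> complex \<Rightarrow> ((nat \<Rightarrow> complex) \<Rightarrow> complex) \<Rightarrow> (nat \<Rightarrow> complex) \<Rightarrow> complex" where
  "schur_op n q g x = (\<Sum>i=1..n. schur_coeff n q x i * (g (x(i := q * x i)) - g x)) +
     (\<Sum>i=1..n. schur_coeff n q (\<lambda>i. inverse (x i)) i * (g (x(i := inverse q * x i)) - g x))"

lemma generic_param_inverse: "generic_param n (\<lambda>i. inverse (x i)) u = generic_param n x u"
  by (simp add: generic_param_def pair_poly_inverse)

lemma schur_op_pair_poly:
  assumes reg: "nodes_regular n x" and gen: "generic_param n x u" and q: "q \<noteq> 0"
  defines "F \<equiv> \<lambda>u x. poly (pair_poly n x) u"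
  shows "q * (1 - u\<^sup>2) * schur_op n q (F u) x =
    (1 + q ^ (2 * n + 2)) * (1 - u\<^sup>2) * F u x - (1 - (q * u)\<^sup>2) * F (q * u) x
      - q ^ (2 * n + 2) * (1 - (u / q)\<^sup>2) * F (u / q) x"
proof -
  let ?y = "\<lambda>i. inverse (x i)"
  have nz: "1 - u\<^sup>2 \<noteq> 0" "F u x \<noteq> 0" using gen by (auto simp: generic_param_def F_def)
  have Finv: "F v (\<lambda>j. inverse (z j)) = F v z" for v z by (simp add: F_def pair_poly_inverse)
  have num: "num_poly n q ?y = num_poly n q x" by (simp add: num_poly_def pair_poly_inverse)
  have shift: "F u (x(i := inverse q * x i)) = F u (?y(i := q * ?y i))" for i
  proof -
    have "?y(i := q * ?y i) = (\<lambda>j. inverse ((x(i := inverse q * x i)) j))" by auto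
    then show ?thesis by (simp only: Finv)
  qed
  let ?r = "\<lambda>z. poly (num_poly n q x) z / (\<Prod>p\<in>ext_nodes n x u - {z}. z - p)"
  have clear: "q * w * (- (f / q) * (- A - 1 + B * b / (w * f) - C * c * d / (w * f))) =
      w * f * (A + 1) - B * b + C * c * d"
    if "q \<noteq> 0" "w \<noteq> 0" "f \<noteq> 0" for w f A B b C c d :: complex
    using that by (simp add: field_simps)
  have RS: "(\<Sum>z\<in>nodes n x. ?r z) =
      - (q ^ (2 * n + 2)) - 1 + (1 - q\<^sup>2 * u\<^sup>2) * F (q * u) x / ((1 - u\<^sup>2) * F u x)
        - (u\<^sup>2 - q\<^sup>2) * q ^ (2 * n) * F (u / q) x / ((1 - u\<^sup>2) * F u x)"
    unfolding F_def by (rule residue_sum[OF reg gen q])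
  have "schur_op n q (F u) x = (\<Sum>i=1..n. - (F u x / q) * ?r (x i)) + (\<Sum>i=1..n. - (F u x / q) * ?r (inverse (x i)))"
    unfolding schur_op_def
  proof (intro arg_cong2[of _ _ _ _ "(+)"] sum.cong refl)
    fix i assume i: "i \<in> {1..n}"
    show "schur_coeff n q x i * (F u (x(i := q * x i)) - F u x) = - (F u x / q) * ?r (x i)"
      using schur_coeff_residue[OF reg gen q i] by (simp add: F_def)
    have "schur_coeff n q ?y i * (F u (?y(i := q * ?y i)) - F u ?y) = - (F u ?y / q) * ?r (inverse (x i))"
      using schur_coeff_residue[OF nodes_regular_inverse[OF reg] _ q i, of u] gen
      unfolding ext_nodes_inverse num generic_param_inverse by (simp add: F_def)
    then show "schur_coeff n q ?y i * (F u (x(i := inverse q * x i)) - F u x) = - (F u x / q) * ?r (inverse (x i))"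
      by (simp only: shift Finv)
  qed
  also have "\<dots> = - (F u x / q) * (\<Sum>z\<in>nodes n x. ?r z)"
    unfolding sum_nodes[OF reg] by (simp add: sum_distrib_left ring_distribs)
  also have "q * (1 - u\<^sup>2) * \<dots> =
    (1 - u\<^sup>2) * F u x * (q ^ (2 * n + 2) + 1) - (1 - q\<^sup>2 * u\<^sup>2) * F (q * u) x
      + (u\<^sup>2 - q\<^sup>2) * q ^ (2 * n) * F (u / q) x"
    unfolding RS by (rule clear[OF q nz])
  also have "(u\<^sup>2 - q\<^sup>2) * q ^ (2 * n) = - (q ^ (2 * n + 2) * (1 - (u / q)\<^sup>2))"
    using q by (simp add: field_simps power_add power2_eq_square)
  finally show ?thesis by (simp add: power_mult_distrib algebra_simps)
qed

definition symp_char :: "nat \<Rightarrow> nat \<Rightarrow> (nat \<Rightarrow> complex) \<Rightarrow> complex" where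
  "symp_char n r x = coeff (symp_poly n x) r"

lemma schur_op_coeff_symp_poly:
  assumes reg: "nodes_regular n x" and q: "q \<noteq> 0"
  shows "q * schur_op n q (symp_char n r) x =
    (1 + q ^ (2 * n + 2) - q ^ r - q ^ (2 * n + 2) / q ^ r) * symp_char n r x"
proof -
  let ?c = "schur_coeff n q x" and ?d = "schur_coeff n q (\<lambda>i. inverse (x i))"
  define L where "L = smult q
     ((\<Sum>i=1..n. smult (?c i) (symp_poly n (x(i := q * x i)) - symp_poly n x)) +
      (\<Sum>i=1..n. smult (?d i) (symp_poly n (x(i := inverse q * x i)) - symp_poly n x)))"
  define T where "T = smult (1 + q ^ (2 * n + 2)) (symp_poly n x)
     - pcompose (symp_poly n x) [:0, q:]
     - smult (q ^ (2 * n + 2)) (pcompose (symp_poly n x) [:0, inverse q:])"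
  have pc: "poly (symp_poly n z) u = (1 - u\<^sup>2) * poly (pair_poly n z) u" for z u
    by (simp add: symp_poly_def power2_eq_square algebra_simps)
  have "poly L u = poly T u" if "generic_param n x u" for u
  proof -
    have "poly L u = q * (1 - u\<^sup>2) * schur_op n q (\<lambda>x. poly (pair_poly n x) u) x"
      unfolding L_def schur_op_def
      by (simp add: poly_sum pc sum_distrib_left ring_distribs mult_ac)
    also have "\<dots> = poly T u"
      unfolding schur_op_pair_poly[OF reg that q] T_def
      by (simp add: poly_pcompose pc divide_inverse mult_ac)
    finally show ?thesis .
  qed
  then have "\<forall>u. poly ((L - T) * ([:0, 1:] * [:-1, 0, 1:] * pair_poly n x)) u = 0"
    by (auto simp: generic_param_def power2_eq_square)
  then have "(L - T) * ([:0, 1:] * [:-1, 0, 1:] * pair_poly n x) = 0"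
    by (simp only: poly_all_0_iff_0)
  moreover have "[:0, 1:] * [:-1, 0, 1::complex:] \<noteq> 0" by simp
  ultimately have "L = T" using pair_poly_nz by (metis mult_eq_0_iff right_minus_eq)
  then have "coeff L r = coeff T r" by simp
  moreover have "coeff L r = q * schur_op n q (symp_char n r) x"
    by (simp add: L_def schur_op_def symp_char_def coeff_sum)
  moreover have "coeff T r =
      (1 + q ^ (2 * n + 2) - q ^ r - q ^ (2 * n + 2) / q ^ r) * symp_char n r x"
    unfolding T_def symp_char_def
    by (simp add: coeff_pcompose_linear algebra_simps divide_inverse power_inverse)
  ultimately show ?thesis by simp
qed

section \<open>Expansion in elementary symmetric functions\<close>

definition esym :: "nat \<Rightarrow> nat \<Rightarrow> (nat \<Rightarrow> complex) \<Rightarrow> complex" where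
  "esym n s x = (\<Sum>S | S \<subseteq> {1..n} \<and> card S = s. \<Prod>i\<in>S. plus_inverse (x i))"

definition column_coeff :: "nat \<Rightarrow> nat \<Rightarrow> nat \<Rightarrow> complex" where
  "column_coeff n r s = (if s \<le> r then coeff ([:1, 0, -1:] * [:1, 0, 1:] ^ (n - s)) (r - s) else 0)"

lemma symp_char_eq_esym:
  "symp_char n r x = (\<Sum>s\<le>n. column_coeff n r s * esym n s x)"
proof -
  let ?A = "{1..n}"
  have "pair_poly n x = (\<Prod>i\<in>?A. monom (plus_inverse (x i)) 1 + [:1, 0, 1:])"
    unfolding pair_poly_def by (intro prod.cong) (simp_all add: monom_altdef)
  also have "\<dots> = (\<Sum>S\<in>Pow ?A. (\<Prod>i\<in>S. monom (plus_inverse (x i)) 1) * [:1, 0, 1:] ^ (n - card S))"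
    by (subst prod_add) (auto intro!: sum.cong simp: card_Diff_subset finite_subset)
  also have "\<dots> = (\<Sum>S\<in>Pow ?A. monom (\<Prod>i\<in>S. plus_inverse (x i)) (card S) * [:1, 0, 1:] ^ (n - card S))"
  proof (intro sum.cong refl)
    fix S assume "S \<in> Pow ?A"
    then have "finite S" by (auto intro: finite_subset)
    then have "(\<Prod>i\<in>S. monom (plus_inverse (x i)) 1) = monom (\<Prod>i\<in>S. plus_inverse (x i)) (card S)"
      by (induction S) (auto simp: mult_monom)
    then show "(\<Prod>i\<in>S. monom (plus_inverse (x i)) 1) * [:1, 0, 1:] ^ (n - card S) =
        monom (\<Prod>i\<in>S. plus_inverse (x i)) (card S) * [:1, 0, 1:] ^ (n - card S)" by simp
  qed
  finally have "symp_poly n x = (\<Sum>S\<in>Pow ?A. monom (\<Prod>i\<in>S. plus_inverse (x i)) (card S) *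
      ([:1, 0, -1:] * [:1, 0, 1:] ^ (n - card S)))"
    unfolding symp_poly_def by (simp only: sum_distrib_left mult.left_commute)
  moreover have *: "coeff (monom a k * p) r = (if k \<le> r then coeff p (r - k) else 0) * a"
    for a :: complex and k p by (simp add: coeff_monom_mult)
  ultimately have "symp_char n r x = (\<Sum>S\<in>Pow ?A. column_coeff n r (card S) * (\<Prod>i\<in>S. plus_inverse (x i)))"
    unfolding symp_char_def by (simp only: coeff_sum * column_coeff_def)
  also have "\<dots> = (\<Sum>s\<le>n. \<Sum>S\<in>{S \<in> Pow ?A. card S = s}. column_coeff n r (card S) * (\<Prod>i\<in>S. plus_inverse (x i)))"
  proof (rule sum.group[symmetric])
    show "card ` Pow ?A \<subseteq> {..n}"
      using card_mono[of ?A] by fastforce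
  qed simp_all
  also have "\<dots> = (\<Sum>s\<le>n. column_coeff n r s * esym n s x)"
    unfolding esym_def by (simp add: sum_distrib_left)
  finally show ?thesis .
qed

lemma coeff_one_plus_sq_power:
  "coeff ([:1, 0, 1::complex:] ^ m) i = (if even i then of_nat (m choose (i div 2)) else 0)"
proof (induction m arbitrary: i)
  case 0
  then show ?case by (auto simp: coeff_1 elim!: evenE)
next
  case (Suc m)
  have "coeff ([:1, 0, 1::complex:] ^ Suc m) i =
      coeff ([:1, 0, 1::complex:] ^ m) i + (if i < 2 then 0 else coeff ([:1, 0, 1::complex:] ^ m) (i - 2))"
    by (auto simp: coeff_pCons split: nat.splits)
  also have "\<dots> = (if even i then of_nat (Suc m choose (i div 2)) else 0)"
  proof (cases "i < 2")
    case True
    then show ?thesis unfolding Suc.IH by (cases "i = 0") auto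
  next
    case False
    then obtain j where "i = Suc (Suc j)" by (metis add_2_eq_Suc le_Suc_ex not_less)
    then show ?thesis unfolding Suc.IH by simp
  qed
  finally show ?case .
qed

lemma coeff_one_minus_sq_mult:
  "coeff ([:1, 0, -1:] * p) i = coeff p i - (if i < 2 then 0 else coeff p (i - 2))"
  for p :: "complex poly"
  by (auto simp: coeff_pCons split: nat.splits)

lemma column_coeff_refl: "column_coeff n r r = 1"
  by (simp add: column_coeff_def coeff_0_power flip: poly_0_coeff_0)

lemma column_coeff_odd: "odd (r - s) \<Longrightarrow> column_coeff n r s = 0"
  unfolding column_coeff_def coeff_one_minus_sq_mult coeff_one_plus_sq_power by auto

lemma column_coeff_even:
  assumes "2 * k \<le> r" "r \<le> n"
  shows "column_coeff n r (r - 2 * k) =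
    of_nat (n - r + 1) / of_nat (n - r + k + 1) * of_nat ((n - r + 2 * k) choose k)"
proof -
  define m where "m = n - r + 2 * k"
  have m: "n - (r - 2 * k) = m" "n - r = m - 2 * k" "2 * k \<le> m" using assms by (auto simp: m_def)
  have "column_coeff n r (r - 2 * k) = coeff ([:1, 0, -1:] * [:1, 0, 1:] ^ m) (2 * k)"
    using assms m by (simp add: column_coeff_def)
  also have "\<dots> = of_nat (m choose k) - (if k = 0 then 0 else of_nat (m choose (k - 1)))"
    unfolding coeff_one_minus_sq_mult coeff_one_plus_sq_power by (cases k) auto
  also have "\<dots> = of_nat (n - r + 1) / of_nat (n - r + k + 1) * of_nat (m choose k)"
  proof (cases k)
    case 0
    have "complex_of_nat (n - r + 1) \<noteq> 0" by (subst of_nat_eq_0_iff) simp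
    with 0 show ?thesis by simp
  next
    case (Suc l)
    have "Suc l * (m choose Suc l) = (m - l) * (m choose l)"
      by (metis binomial_absorb_comp binomial_absorption)
    then have "complex_of_nat (Suc l * (m choose Suc l)) = of_nat ((m - l) * (m choose l))"
      by (rule arg_cong)
    then have e: "of_nat (Suc l) * complex_of_nat (m choose Suc l) = of_nat (m - l) * of_nat (m choose l)"
      by (simp only: of_nat_mult)
    have d: "n - r + k + 1 = m - l" "n - r + 1 + Suc l = m - l" "m - l \<noteq> 0"
      using m Suc by auto
    have "(complex_of_nat (m choose k) - of_nat (m choose l)) * of_nat (m - l) =
        of_nat (m choose k) * (of_nat (m - l) - of_nat (Suc l))"
      using e unfolding Suc by (simp add: algebra_simps)
    also have "complex_of_nat (m - l) - of_nat (Suc l) = of_nat (n - r + 1)"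
      using d(2) by (metis add_diff_cancel_right' of_nat_add)
    finally show ?thesis unfolding d(1) using d(3) Suc
      by (simp add: field_simps del: of_nat_Suc of_nat_diff of_nat_add)
  qed
  finally show ?thesis by (simp add: m_def)
qed

section \<open>Triangularity and uniqueness\<close>

lemma schur_op_sum:
  "schur_op n q (\<lambda>x. \<Sum>s\<in>A. b s * f s x) x = (\<Sum>s\<in>A. b s * schur_op n q (f s) x)"
proof -
  have *: "(\<Sum>i\<in>I. c i * ((\<Sum>s\<in>A. b s * f s (z i)) - (\<Sum>s\<in>A. b s * f s x))) =
      (\<Sum>s\<in>A. b s * (\<Sum>i\<in>I. c i * (f s (z i) - f s x)))" for I c and z :: "nat \<Rightarrow> nat \<Rightarrow> complex"
  proof -
    have "(\<Sum>i\<in>I. c i * ((\<Sum>s\<in>A. b s * f s (z i)) - (\<Sum>s\<in>A. b s * f s x))) =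
        (\<Sum>i\<in>I. \<Sum>s\<in>A. b s * (c i * (f s (z i) - f s x)))"
      by (simp add: sum_distrib_left right_diff_distrib sum_subtractf mult_ac)
    also have "\<dots> = (\<Sum>s\<in>A. b s * (\<Sum>i\<in>I. c i * (f s (z i) - f s x)))"
      by (subst sum.swap) (simp only: sum_distrib_left)
    finally show ?thesis .
  qed
  show ?thesis unfolding schur_op_def * by (simp add: distrib_left sum.distrib)
qed

definition schur_eigenvalue :: "nat \<Rightarrow> complex \<Rightarrow> nat \<Rightarrow> complex" where
  "schur_eigenvalue n q r = (1 + q ^ (2 * n + 2) - q ^ r - q ^ (2 * n + 2) / q ^ r) / q"

lemma schur_op_symp_char:
  assumes "nodes_regular n x" "q \<noteq> 0"
  shows "schur_op n q (symp_char n r) x = schur_eigenvalue n q r * symp_char n r x"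
  using schur_op_coeff_symp_poly[OF assms, of r] assms(2) by (simp add: schur_eigenvalue_def field_simps)

lemma symp_char_split:
  assumes "r \<le> n"
  shows "symp_char n r x = (\<Sum>s\<le>r. column_coeff n r s * esym n s x)"
  unfolding symp_char_eq_esym using assms
  by (intro sum.mono_neutral_right) (auto simp: column_coeff_def)

lemma schur_op_esym_triangular:
  assumes q: "q \<noteq> 0" and "s \<le> n"
  shows "\<exists>M. \<forall>x. nodes_regular n x \<longrightarrow>
    schur_op n q (esym n s) x = schur_eigenvalue n q s * esym n s x + (\<Sum>j<s. M j * esym n j x)"
  using \<open>s \<le> n\<close>
proof (induction s rule: less_induct)
  case (less s)
  have "\<forall>j\<in>{..<s}. \<exists>M. \<forall>x. nodes_regular n x \<longrightarrow>
      schur_op n q (esym n j) x = schur_eigenvalue n q j * esym n j x + (\<Sum>i<j. M i * esym n i x)"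
    using less by simp
  then obtain M where M: "schur_op n q (esym n j) x = schur_eigenvalue n q j * esym n j x + (\<Sum>i<j. M j i * esym n i x)"
    if "j < s" "nodes_regular n x" for j x
    unfolding bchoice_iff by auto
  let ?c = "column_coeff n s"
  define M' where "M' j = ?c j * (schur_eigenvalue n q s - schur_eigenvalue n q j) -
    (\<Sum>i<s. ?c i * (if j < i then M i j else 0))" for j
  have *: "symp_char n s x = (\<Sum>j<s. ?c j * esym n j x) + esym n s x" for x
    unfolding symp_char_split[OF less.prems]
    by (simp add: lessThan_Suc_atMost[symmetric] column_coeff_refl)
  show ?case
  proof (intro exI[of _ M'] allI impI)
    fix x assume x: "nodes_regular n x"
    have eq: "symp_char n s = (\<lambda>x. \<Sum>j\<in>{..s}. ?c j * esym n j x)"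
      using symp_char_split[OF less.prems] by auto
    have "schur_eigenvalue n q s * symp_char n s x = schur_op n q (symp_char n s) x"
      using schur_op_symp_char[OF x q] by simp
    also have "\<dots> = (\<Sum>j<s. ?c j * schur_op n q (esym n j) x) + schur_op n q (esym n s) x"
      unfolding eq schur_op_sum by (simp add: lessThan_Suc_atMost[symmetric] column_coeff_refl)
    also have "(\<Sum>j<s. ?c j * schur_op n q (esym n j) x) =
        (\<Sum>j<s. ?c j * schur_eigenvalue n q j * esym n j x) + (\<Sum>j<s. \<Sum>i<s. ?c j * (if i < j then M j i else 0) * esym n i x)"
    proof -
      have "?c j * schur_op n q (esym n j) x = ?c j * schur_eigenvalue n q j * esym n j x +
          (\<Sum>i<s. ?c j * (if i < j then M j i else 0) * esym n i x)" if "j < s" for j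
      proof -
        have "(\<Sum>i<s. ?c j * (if i < j then M j i else 0) * esym n i x) =
            (\<Sum>i<j. ?c j * (if i < j then M j i else 0) * esym n i x)"
          using that by (intro sum.mono_neutral_right) auto
        also have "\<dots> = ?c j * (\<Sum>i<j. M j i * esym n i x)"
          by (simp add: sum_distrib_left mult.assoc)
        finally show ?thesis using M[OF that x] by (simp add: algebra_simps)
      qed
      then show ?thesis by (simp add: sum.distrib)
    qed
    also have "(\<Sum>j<s. \<Sum>i<s. ?c j * (if i < j then M j i else 0) * esym n i x) =
        (\<Sum>i<s. (\<Sum>j<s. ?c j * (if i < j then M j i else 0)) * esym n i x)"
      by (subst sum.swap) (simp only: sum_distrib_right)
    finally have schur_op: "schur_eigenvalue n q s * symp_char n s x =
        (\<Sum>j<s. ?c j * schur_eigenvalue n q j * esym n j x) +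
        (\<Sum>i<s. (\<Sum>j<s. ?c j * (if i < j then M j i else 0)) * esym n i x) + schur_op n q (esym n s) x" .
    have "(\<Sum>j<s. M' j * esym n j x) = schur_eigenvalue n q s * (\<Sum>j<s. ?c j * esym n j x) -
        (\<Sum>j<s. ?c j * schur_eigenvalue n q j * esym n j x) -
        (\<Sum>i<s. (\<Sum>j<s. ?c j * (if i < j then M j i else 0)) * esym n i x)"
      by (simp add: M'_def left_diff_distrib right_diff_distrib sum_subtractf sum_distrib_left mult_ac)
    moreover have "k = l * e + m" if "m = l * c - A - B" "l * (c + e) = A + B + k"
      for k l e m c A B :: complex
    proof -
      have "k = l * (c + e) - A - B" using that(2) by simp
      then show ?thesis unfolding that(1) by (simp add: algebra_simps)
    qed
    ultimately show "schur_op n q (esym n s) x = schur_eigenvalue n q s * esym n s x + (\<Sum>j<s. M' j * esym n j x)"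
      using schur_op unfolding * by blast
  qed
qed

lemma esym_const: "esym n s (\<lambda>_. z) = of_nat (n choose s) * plus_inverse z ^ s"
proof -
  have "esym n s (\<lambda>_. z) = (\<Sum>S | S \<subseteq> {1..n} \<and> card S = s. plus_inverse z ^ s)"
    unfolding esym_def by (intro sum.cong) auto
  then show ?thesis using n_subsets[of "{1..n}" s] by simp
qed

lemma plus_inverse_inj:
  assumes "z * w \<noteq> 1" "z \<noteq> 0" "w \<noteq> 0" "plus_inverse z = plus_inverse w"
  shows "z = w"
proof -
  have "(z - w) * (z * w - 1) = z * w * (plus_inverse z - plus_inverse w)"
    using assms by (simp add: plus_inverse_def field_simps)
  then show ?thesis using assms by simp
qed

text \<open>
  At the point \<open>(X, \<dots>, X)\<close> the relation becomes a polynomial in \<open>X + 1/X\<close>; that point is not regular,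
  but it is the limit as \<open>\<delta> \<rightarrow> 0\<close> of the regular points \<open>(X + i\<delta>)\<^sub>i\<close>.
\<close>

lemma esym_independent:
  assumes q: "q \<noteq> 0" "norm q < 1" and m: "m \<le> Suc n"
    and zero: "\<And>x. koornwinder_regular n q x \<Longrightarrow> (\<Sum>s<m. b s * esym n s x) = 0"
    and s: "s < m"
  shows "b s = 0"
proof -
  have big: "(\<Sum>s<m. b s * esym n s (\<lambda>_. of_real X)) = 0" if X: "X > 1 / norm q" for X :: real
  proof -
    define x where "x \<delta> i = (of_real (X + real i * \<delta>) :: complex)" for \<delta> i
    have X1: "X > 1" using X q by (smt (verit) less_divide_eq_1 zero_less_norm_iff)
    have reg: "koornwinder_regular n q (x \<delta>)" if \<delta>: "\<delta> > 0" for \<delta>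
    proof -
      have ge: "X + real i * \<delta> \<ge> X" for i using \<delta> by simp
      have n1: "norm (x \<delta> i) \<ge> X" for i
        using ge[of i] X1 unfolding x_def norm_of_real by linarith
      have nn: "norm (x \<delta> i * x \<delta> j) > X" for i j
      proof -
        have "X * 1 < X * X" using X1 by (intro mult_strict_left_mono) auto
        also have "\<dots> \<le> norm (x \<delta> i) * norm (x \<delta> j)"
          using n1[of i] n1[of j] X1 by (intro mult_mono) auto
        finally show ?thesis by (simp add: norm_mult)
      qed
      have "norm (q * (x \<delta> i)\<^sup>2) > 1" for i
      proof -
        have "1 < norm q * X" using X q by (simp add: field_simps)
        also have "\<dots> < norm q * norm (x \<delta> i * x \<delta> i)"
          using nn[of i i] q by (intro mult_strict_left_mono) auto
        finally show ?thesis by (simp add: norm_mult power2_eq_square)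
      qed
      then have 1: "q * (x \<delta> i)\<^sup>2 \<noteq> 1" for i by (metis less_irrefl norm_one)
      have 2: "x \<delta> i * x \<delta> j \<noteq> 1" for i j using nn[of i j] X1 by auto
      have 3: "(x \<delta> i)\<^sup>2 \<noteq> q" for i
        using nn[of i i] X1 q by (auto simp: power2_eq_square)
      have 4: "x \<delta> i \<noteq> 0" for i using n1[of i] X1 by auto
      have 5: "x \<delta> i \<noteq> x \<delta> j" if "i \<noteq> j" for i j
        using that \<delta> unfolding x_def of_real_eq_iff by simp
      show ?thesis unfolding koornwinder_regular_def
        using 1 2 3 4 5 by (auto simp: power2_eq_square)
    qed
    have "((\<lambda>\<delta>. \<Sum>s<m. b s * esym n s (x \<delta>)) \<longlongrightarrow> (\<Sum>s<m. b s * esym n s (x 0))) (at_right 0)"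
      unfolding esym_def plus_inverse_def x_def using X1 by (intro tendsto_intros) auto
    moreover have "eventually (\<lambda>\<delta>. (\<Sum>s<m. b s * esym n s (x \<delta>)) = 0) (at_right 0)"
      using eventually_at_right_less[of "0::real"] by eventually_elim (use zero reg in auto)
    then have "((\<lambda>\<delta>. \<Sum>s<m. b s * esym n s (x \<delta>)) \<longlongrightarrow> 0) (at_right 0)"
      by (rule tendsto_eventually)
    ultimately have "(\<Sum>s<m. b s * esym n s (x 0)) = 0"
      using tendsto_unique trivial_limit_at_right_real by blast
    moreover have "x 0 = (\<lambda>_. of_real X)" by (auto simp: x_def)
    ultimately show ?thesis by simp
  qed
  define p where "p = (\<Sum>s<m. monom (b s * of_nat (n choose s)) s)"
  have roots: "(\<lambda>X. plus_inverse (of_real X)) ` {1 / norm q<..} \<subseteq> {y. poly p y = 0}"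
    using big by (auto simp: p_def poly_sum poly_monom esym_const mult_ac)
  have "inj_on (\<lambda>X. plus_inverse (of_real X)) {1 / norm q<..}"
  proof (rule inj_onI)
    fix X Y :: real
    assume *: "X \<in> {1 / norm q<..}" "Y \<in> {1 / norm q<..}" "plus_inverse (of_real X) = plus_inverse (of_real Y)"
    have "1 / norm q > 1" using q by simp
    then have "X > 1" "Y > 1" using * by (auto simp del: less_divide_eq_1_pos)
    then have "X * Y > 1" using less_1_mult by blast
    then have "complex_of_real X * of_real Y \<noteq> 1" by (simp flip: of_real_mult)
    then show "X = Y" using plus_inverse_inj[of "of_real X" "of_real Y"] * \<open>X > 1\<close> \<open>Y > 1\<close> by simp
  qed
  then have "infinite ((\<lambda>X. plus_inverse (of_real X)) ` {1 / norm q<..})"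
    using infinite_Ioi finite_imageD by blast
  then have "p = 0" using roots poly_roots_finite finite_subset by blast
  then have "coeff p s = 0" by simp
  then have "b s * of_nat (n choose s) = 0" using s by (simp add: p_def coeff_sum)
  then show ?thesis using s m by simp
qed

lemma regular_nodes_regular: "koornwinder_regular n q x \<Longrightarrow> nodes_regular n x"
  unfolding koornwinder_regular_def nodes_regular_def inj_on_def
  by (metis power2_eq_square)

lemma schur_eigenvalue_inj:
  assumes q: "q \<noteq> 0" "norm q < 1" and "s < r" "r \<le> n"
  shows "schur_eigenvalue n q s \<noteq> schur_eigenvalue n q r"
proof
  have inj: "a = b" if "q ^ a = q ^ b" for a b
  proof -
    have "norm q ^ a = norm q ^ b" using that by (metis norm_power)
    then show ?thesis using q by (metis linorder_neqE_nat order_less_irrefl power_strict_decreasing zero_less_norm_iff)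
  qed
  assume "schur_eigenvalue n q s = schur_eigenvalue n q r"
  then have "q ^ s + q ^ (2 * n + 2) / q ^ s = q ^ r + q ^ (2 * n + 2) / q ^ r"
    using q(1) by (simp add: schur_eigenvalue_def algebra_simps)
  then have "(q ^ (s + r) - q ^ (2 * n + 2)) * (q ^ s - q ^ r) = 0"
    using q(1) unfolding power_add by (simp add: field_simps)
  then have "s + r = 2 * n + 2 \<or> s = r" using inj by auto
  then show False using assms by linarith
qed

lemma eigen_zero:
  assumes q: "q \<noteq> 0" "norm q < 1" and "r \<le> n"
    and eig: "\<And>x. koornwinder_regular n q x \<Longrightarrow>
      schur_op n q (\<lambda>x. \<Sum>s<r. b s * esym n s x) x = schur_eigenvalue n q r * (\<Sum>s<r. b s * esym n s x)"
    and "s < r"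
  shows "b s = 0"
proof -
  have "\<forall>j\<in>{..<r}. \<exists>M. \<forall>x. nodes_regular n x \<longrightarrow>
      schur_op n q (esym n j) x = schur_eigenvalue n q j * esym n j x + (\<Sum>i<j. M i * esym n i x)"
    using schur_op_esym_triangular[OF q(1)] \<open>r \<le> n\<close> by simp
  then obtain M where M: "schur_op n q (esym n j) x = schur_eigenvalue n q j * esym n j x + (\<Sum>i<j. M j i * esym n i x)"
    if "j < r" "nodes_regular n x" for j x
    unfolding bchoice_iff by auto
  define b' where "b' j = b j * (schur_eigenvalue n q j - schur_eigenvalue n q r) +
    (\<Sum>i<r. b i * (if j < i then M i j else 0))" for j
  have "(\<Sum>j<r. b' j * esym n j x) = 0" if x: "koornwinder_regular n q x" for x
  proof -
    have "schur_op n q (\<lambda>x. \<Sum>s<r. b s * esym n s x) x =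
        (\<Sum>j<r. b j * schur_eigenvalue n q j * esym n j x) + (\<Sum>j<r. \<Sum>i<r. b j * (if i < j then M j i else 0) * esym n i x)"
    proof -
      have "b j * schur_op n q (esym n j) x = b j * schur_eigenvalue n q j * esym n j x +
          (\<Sum>i<r. b j * (if i < j then M j i else 0) * esym n i x)" if "j < r" for j
      proof -
        have "(\<Sum>i<r. b j * (if i < j then M j i else 0) * esym n i x) =
            (\<Sum>i<j. b j * (if i < j then M j i else 0) * esym n i x)"
          using that by (intro sum.mono_neutral_right) auto
        also have "\<dots> = b j * (\<Sum>i<j. M j i * esym n i x)"
          by (simp add: sum_distrib_left mult.assoc)
        finally show ?thesis using M[OF that regular_nodes_regular[OF x]] by (simp add: algebra_simps)
      qed
      then show ?thesis by (simp add: schur_op_sum sum.distrib)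
    qed
    also have "(\<Sum>j<r. \<Sum>i<r. b j * (if i < j then M j i else 0) * esym n i x) =
        (\<Sum>i<r. (\<Sum>j<r. b j * (if i < j then M j i else 0)) * esym n i x)"
      by (subst sum.swap) (simp only: sum_distrib_right)
    finally show ?thesis unfolding eig[OF x] b'_def
      by (simp add: left_diff_distrib sum_subtractf right_diff_distrib distrib_right distrib_left sum.distrib sum_distrib_left mult_ac)
  qed
  then have b'0: "b' j = 0" if "j < r" for j
    using esym_independent[OF q, of r n b'] that \<open>r \<le> n\<close> by simp
  show ?thesis using \<open>s < r\<close>
  proof (induction "r - s" arbitrary: s rule: less_induct)
    case less
    have "b i * (if s < i then M i s else 0) = 0" if "i < r" for i
      using less.hyps[of i] that less.prems by auto
    then have "(\<Sum>i<r. b i * (if s < i then M i s else 0)) = 0" by (intro sum.neutral) auto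
    then have "b' s = b s * (schur_eigenvalue n q s - schur_eigenvalue n q r)" by (simp add: b'_def)
    then show ?case using b'0[OF less.prems] schur_eigenvalue_inj[OF q less.prems \<open>r \<le> n\<close>] by simp
  qed
qed

section \<open>One-column monomial symmetric functions\<close>

lemma lookup_one_column:
  "Poly_Mapping.lookup (one_column r) i = (if i \<in> {1..r} then 1 else 0)"
  by (auto simp: one_column_def lookup_sum lookup_single when_def)

lemma keys_one_column: "Poly_Mapping.keys (one_column r) = {1..r}"
  by (auto simp: in_keys_iff lookup_one_column split: if_splits)

definition col_orbit :: "nat \<Rightarrow> nat \<Rightarrow> expo set" where
  "col_orbit n s = {\<nu>. Poly_Mapping.keys \<nu> \<subseteq> {1..n} \<and> card (Poly_Mapping.keys \<nu>) = s \<and>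
     (\<forall>i. Poly_Mapping.lookup \<nu> i \<in> {-1, 0, 1})}"

lemma col_orbit_W_invariant:
  assumes "\<nu> \<in> W_orbit n \<mu>"
  shows "\<nu> \<in> col_orbit n s \<longleftrightarrow> \<mu> \<in> col_orbit n s"
proof -
  obtain \<pi> \<epsilon> where \<pi>: "\<pi> permutes {1..n}" and \<epsilon>: "\<And>i. \<epsilon> i \<in> {1, -1::int}"
    and \<nu>: "\<And>i. Poly_Mapping.lookup \<nu> i = \<epsilon> i * Poly_Mapping.lookup \<mu> (\<pi> i)"
    using assms by (auto simp: W_orbit_def)
  have e0: "\<epsilon> i \<noteq> 0" for i using \<epsilon>[of i] by auto
  have keys: "Poly_Mapping.keys \<mu> = \<pi> ` Poly_Mapping.keys \<nu>"
  proof (intro set_eqI iffI)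
    fix j assume "j \<in> Poly_Mapping.keys \<mu>"
    moreover have "j = \<pi> (inv \<pi> j)" using \<pi> by (simp add: permutes_inverses)
    ultimately show "j \<in> \<pi> ` Poly_Mapping.keys \<nu>"
      by (metis \<nu> e0 image_eqI in_keys_iff mult_eq_0_iff)
  qed (use \<nu> e0 in \<open>auto simp: in_keys_iff\<close>)
  have "inj \<pi>" using \<pi> by (rule permutes_inj)
  then have "card (Poly_Mapping.keys \<mu>) = card (Poly_Mapping.keys \<nu>)"
    unfolding keys by (meson card_image inj_on_subset subset_UNIV)
  moreover have "Poly_Mapping.keys \<mu> \<subseteq> {1..n} \<longleftrightarrow> Poly_Mapping.keys \<nu> \<subseteq> {1..n}"
    unfolding keys image_subset_iff using permutes_in_image[OF \<pi>] by blast
  moreover have "(\<forall>i. Poly_Mapping.lookup \<mu> i \<in> {-1, 0, 1}) \<longleftrightarrow>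
      (\<forall>i. Poly_Mapping.lookup \<nu> i \<in> {-1, 0, 1})"
  proof -
    have "Poly_Mapping.lookup \<nu> i \<in> {-1, 0, 1} \<longleftrightarrow> Poly_Mapping.lookup \<mu> (\<pi> i) \<in> {-1, 0, 1}" for i
      using \<epsilon>[of i] by (auto simp: \<nu>)
    moreover have "\<exists>i. \<pi> i = j" for j using \<pi> by (metis permutes_inverses(1))
    ultimately show ?thesis by metis
  qed
  ultimately show ?thesis by (simp add: col_orbit_def)
qed

lemma W_orbit_one_column:
  assumes "s \<le> n"
  shows "W_orbit n (one_column s) = col_orbit n s"
proof (intro set_eqI iffI)
  fix \<nu> assume "\<nu> \<in> W_orbit n (one_column s)"
  moreover have "one_column s \<in> col_orbit n s"
    using assms by (auto simp: col_orbit_def keys_one_column lookup_one_column)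
  ultimately show "\<nu> \<in> col_orbit n s" by (simp add: col_orbit_W_invariant)
next
  fix \<nu> assume \<nu>: "\<nu> \<in> col_orbit n s"
  define S where "S = Poly_Mapping.keys \<nu>"
  have S: "S \<subseteq> {1..n}" "card S = s" "finite S" using \<nu> by (auto simp: col_orbit_def S_def)
  obtain f where f: "bij_betw f S {1..s}"
    using S by (metis finite_same_card_bij finite_atLeastAtMost card_atLeastAtMost diff_Suc_1)
  have "card ({1..n} - S) = card ({1..n} - {1..s})"
    using S assms by (simp add: card_Diff_subset)
  then obtain g where g: "bij_betw g ({1..n} - S) ({1..n} - {1..s})"
    using finite_same_card_bij by blast
  define \<pi> where "\<pi> i = (if i \<in> {1..n} then if i \<in> S then f i else g i else i)" for i
  have "bij_betw \<pi> S {1..s}" using f S by (subst bij_betw_cong[where g = f]) (auto simp: \<pi>_def)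
  moreover have "bij_betw \<pi> ({1..n} - S) ({1..n} - {1..s})"
    using g by (subst bij_betw_cong[where g = g]) (auto simp: \<pi>_def)
  ultimately have "bij_betw \<pi> (S \<union> ({1..n} - S)) ({1..s} \<union> ({1..n} - {1..s}))"
    by (rule bij_betw_combine) auto
  moreover have "S \<union> ({1..n} - S) = {1..n}" "{1..s} \<union> ({1..n} - {1..s}) = {1..n}"
    using S assms by auto
  ultimately have "\<pi> permutes {1..n}" by (intro bij_imp_permutes) (auto simp: \<pi>_def)
  moreover have "Poly_Mapping.lookup \<nu> i =
      (if i \<in> S then Poly_Mapping.lookup \<nu> i else 1) * Poly_Mapping.lookup (one_column s) (\<pi> i)" for i
  proof (cases "i \<in> S")
    case True
    then have "\<pi> i \<in> {1..s}" using f S by (auto simp: \<pi>_def bij_betw_def)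
    then show ?thesis using True by (simp add: lookup_one_column)
  next
    case False
    have "\<pi> i \<notin> {1..s}"
    proof (cases "i \<in> {1..n}")
      case True
      then have "g i \<in> {1..n} - {1..s}" using False g by (auto simp: bij_betw_def)
      then show ?thesis using True False by (simp add: \<pi>_def)
    qed (use assms in \<open>auto simp: \<pi>_def\<close>)
    then have "Poly_Mapping.lookup (one_column s) (\<pi> i) = 0" by (simp add: lookup_one_column)
    then show ?thesis using False by (simp add: S_def in_keys_iff)
  qed
  moreover have "(if i \<in> S then Poly_Mapping.lookup \<nu> i else 1) \<in> {1, -1}" for i
    using \<nu> by (auto simp: S_def in_keys_iff col_orbit_def)
  ultimately show "\<nu> \<in> W_orbit n (one_column s)"
    unfolding W_orbit_def
    by (intro CollectI exI[of _ \<pi>] exI[of _ "\<lambda>i. if i \<in> S then Poly_Mapping.lookup \<nu> i else 1"]) blast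
qed

definition sign_vec :: "nat set \<Rightarrow> nat set \<Rightarrow> expo" where
  "sign_vec S X = (\<Sum>i\<in>S. Poly_Mapping.single i (if i \<in> X then 1 else -1))"

lemma lookup_sign_vec:
  "finite S \<Longrightarrow> Poly_Mapping.lookup (sign_vec S X) i = (if i \<in> S then if i \<in> X then 1 else -1 else 0)"
  by (auto simp: sign_vec_def lookup_sum lookup_single when_def)

lemma keys_sign_vec: "finite S \<Longrightarrow> Poly_Mapping.keys (sign_vec S X) = S"
  by (auto simp: in_keys_iff lookup_sign_vec split: if_splits)

lemma sign_vec_eq:
  assumes "\<nu> \<in> col_orbit n s"
  shows "sign_vec (Poly_Mapping.keys \<nu>) {i \<in> Poly_Mapping.keys \<nu>. Poly_Mapping.lookup \<nu> i = 1} = \<nu>"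
proof (rule poly_mapping_eqI)
  fix i
  have "Poly_Mapping.lookup \<nu> i \<in> {-1, 0, 1}" using assms by (simp add: col_orbit_def)
  then show "Poly_Mapping.lookup (sign_vec (Poly_Mapping.keys \<nu>)
      {i \<in> Poly_Mapping.keys \<nu>. Poly_Mapping.lookup \<nu> i = 1}) i = Poly_Mapping.lookup \<nu> i"
    by (auto simp: lookup_sign_vec in_keys_iff)
qed

lemma finite_col_orbit [simp]: "finite (col_orbit n s)"
proof (rule finite_subset)
  show "col_orbit n s \<subseteq> (\<lambda>(S, X). sign_vec S X) ` (Pow {1..n} \<times> Pow {1..n})"
  proof
    fix \<nu> assume \<nu>: "\<nu> \<in> col_orbit n s"
    then have "Poly_Mapping.keys \<nu> \<subseteq> {1..n}" by (simp add: col_orbit_def)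
    then show "\<nu> \<in> (\<lambda>(S, X). sign_vec S X) ` (Pow {1..n} \<times> Pow {1..n})"
      using sign_vec_eq[OF \<nu>] by (intro image_eqI[of _ _ "(Poly_Mapping.keys \<nu>,
        {i \<in> Poly_Mapping.keys \<nu>. Poly_Mapping.lookup \<nu> i = 1})"]) auto
  qed
qed auto

definition mono_eval :: "(nat \<Rightarrow> complex) \<Rightarrow> expo \<Rightarrow> complex" where
  "mono_eval x \<mu> = (\<Prod>i\<in>Poly_Mapping.keys \<mu>. x i powi Poly_Mapping.lookup \<mu> i)"

lemma sum_mono_eval_col_orbit: "(\<Sum>\<nu>\<in>col_orbit n s. mono_eval x \<nu>) = esym n s x"
proof -
  let ?T = "{S. S \<subseteq> {1..n} \<and> card S = s}"
  have "(\<Sum>\<nu>\<in>col_orbit n s. mono_eval x \<nu>) =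
      (\<Sum>S\<in>?T. \<Sum>\<nu> | \<nu> \<in> col_orbit n s \<and> Poly_Mapping.keys \<nu> = S. mono_eval x \<nu>)"
    by (rule sum.group[OF finite_col_orbit, symmetric]) (auto simp: col_orbit_def)
  also have "\<dots> = (\<Sum>S\<in>?T. \<Prod>i\<in>S. plus_inverse (x i))"
  proof (intro sum.cong refl)
    fix S assume S: "S \<in> ?T"
    then have fin: "finite S" using finite_subset by blast
    have "(\<Sum>\<nu> | \<nu> \<in> col_orbit n s \<and> Poly_Mapping.keys \<nu> = S. mono_eval x \<nu>) =
        (\<Sum>X\<in>Pow S. (\<Prod>i\<in>X. x i) * (\<Prod>i\<in>S - X. inverse (x i)))"
    proof (rule sum.reindex_bij_witness[of _ "sign_vec S" "\<lambda>\<nu>. {i \<in> S. Poly_Mapping.lookup \<nu> i = 1}"])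
      fix \<nu> assume \<nu>: "\<nu> \<in> {\<nu> \<in> col_orbit n s. Poly_Mapping.keys \<nu> = S}"
      then show "sign_vec S {i \<in> S. Poly_Mapping.lookup \<nu> i = 1} = \<nu>" using sign_vec_eq by auto
      let ?X = "{i \<in> S. Poly_Mapping.lookup \<nu> i = 1}"
      have "mono_eval x \<nu> = (\<Prod>i\<in>?X. x i powi Poly_Mapping.lookup \<nu> i) * (\<Prod>i\<in>S - ?X. x i powi Poly_Mapping.lookup \<nu> i)"
        using \<nu> fin unfolding mono_eval_def by (subst prod.subset_diff[of ?X]) (auto simp: mult.commute)
      also have "\<dots> = (\<Prod>i\<in>?X. x i) * (\<Prod>i\<in>S - ?X. inverse (x i))"
      proof (intro arg_cong2[of _ _ _ _ "(*)"] prod.cong refl)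
        fix i assume i: "i \<in> S - ?X"
        have "Poly_Mapping.lookup \<nu> i \<in> {-1, 0, 1}" using \<nu> by (simp add: col_orbit_def)
        then have "Poly_Mapping.lookup \<nu> i = -1" using i \<nu> by (auto simp: in_keys_iff)
        then show "x i powi Poly_Mapping.lookup \<nu> i = inverse (x i)" by (simp add: power_int_minus)
      qed auto
      finally show "(\<Prod>i\<in>?X. x i) * (\<Prod>i\<in>S - ?X. inverse (x i)) = mono_eval x \<nu>" ..
    next
      fix X assume "X \<in> Pow S"
      then have "X \<subseteq> S" by simp
      have "Poly_Mapping.lookup (sign_vec S X) i = 1 \<longleftrightarrow> i \<in> X" if "i \<in> S" for i
        using that by (simp add: lookup_sign_vec[OF fin])
      then show "{i \<in> S. Poly_Mapping.lookup (sign_vec S X) i = 1} = X"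
        using \<open>X \<subseteq> S\<close> by blast
      show "sign_vec S X \<in> {\<nu> \<in> col_orbit n s. Poly_Mapping.keys \<nu> = S}"
        using S by (simp add: col_orbit_def keys_sign_vec[OF fin] lookup_sign_vec[OF fin])
    qed auto
    also have "\<dots> = (\<Prod>i\<in>S. plus_inverse (x i))"
      unfolding plus_inverse_def by (rule prod_add[OF fin, symmetric])
    finally show "(\<Sum>\<nu> | \<nu> \<in> col_orbit n s \<and> Poly_Mapping.keys \<nu> = S. mono_eval x \<nu>) = (\<Prod>i\<in>S. plus_inverse (x i))" .
  qed
  finally show ?thesis by (simp add: esym_def)
qed

lemma laurent_eval_superset:
  assumes "finite K" "Poly_Mapping.keys p \<subseteq> K"
  shows "laurent_eval p x = (\<Sum>\<mu>\<in>K. Poly_Mapping.lookup p \<mu> * mono_eval x \<mu>)"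
  unfolding laurent_eval_def mono_eval_def using assms
  by (intro sum.mono_neutral_left) (auto simp: in_keys_iff)

lemma laurent_eval_add: "laurent_eval (p + p') x = laurent_eval p x + laurent_eval p' x"
proof -
  let ?K = "Poly_Mapping.keys p \<union> Poly_Mapping.keys p'"
  have "Poly_Mapping.keys (p + p') \<subseteq> ?K" by (rule keys_add)
  then show ?thesis
    by (simp add: laurent_eval_superset[of ?K] lookup_add distrib_right sum.distrib)
qed

lemma laurent_eval_sum: "laurent_eval (\<Sum>s\<in>A. f s) x = (\<Sum>s\<in>A. laurent_eval (f s) x)"
  by (induction A rule: infinite_finite_induct)
    (simp_all add: laurent_eval_add, simp_all add: laurent_eval_def)

lemma laurent_eval_single: "laurent_eval (Poly_Mapping.single \<mu> u) x = u * mono_eval x \<mu>"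
  by (subst laurent_eval_superset[of "{\<mu>}"]) auto

lemma const_mult_column:
  assumes "s \<le> n"
  shows "laurent_const u * monomial_sym n (one_column s) =
    (\<Sum>\<mu>\<in>col_orbit n s. Poly_Mapping.single \<mu> u)"
  by (simp add: laurent_const_def monomial_sym_def W_orbit_one_column[OF assms]
      sum_distrib_left mult_single)

definition column_comb :: "nat \<Rightarrow> (nat \<Rightarrow> complex) \<Rightarrow> nat \<Rightarrow> laurent" where
  "column_comb n c r = (\<Sum>s\<le>r. laurent_const (c s) * monomial_sym n (one_column s))"

lemma laurent_eval_column_comb:
  assumes "r \<le> n"
  shows "laurent_eval (column_comb n c r) x = (\<Sum>s\<le>r. c s * esym n s x)"
  unfolding column_comb_def laurent_eval_sum
proof (intro sum.cong refl)
  fix s assume "s \<in> {..r}"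
  then have "s \<le> n" using assms by simp
  then show "laurent_eval (laurent_const (c s) * monomial_sym n (one_column s)) x = c s * esym n s x"
    by (simp add: const_mult_column laurent_eval_sum laurent_eval_single flip: sum_mono_eval_col_orbit sum_distrib_left)
qed

lemma lookup_column_comb:
  assumes "r \<le> n"
  shows "Poly_Mapping.lookup (column_comb n c r) \<nu> = (\<Sum>s\<le>r. if \<nu> \<in> col_orbit n s then c s else 0)"
  unfolding column_comb_def lookup_sum
proof (intro sum.cong refl)
  fix s assume "s \<in> {..r}"
  then have "s \<le> n" using assms by simp
  then show "Poly_Mapping.lookup (laurent_const (c s) * monomial_sym n (one_column s)) \<nu> =
      (if \<nu> \<in> col_orbit n s then c s else 0)"
    by (simp add: const_mult_column lookup_sum lookup_single when_def)
qed

lemma column_comb_W_invariant: "r \<le> n \<Longrightarrow> W_invariant n (column_comb n c r)"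
  unfolding W_invariant_def by (simp add: lookup_column_comb col_orbit_W_invariant)

lemma column_comb_laurent_in:
  assumes "r \<le> n" shows "laurent_in n (column_comb n c r)"
  unfolding laurent_in_def
proof
  fix \<mu> assume "\<mu> \<in> Poly_Mapping.keys (column_comb n c r)"
  then have "(\<Sum>s\<le>r. if \<mu> \<in> col_orbit n s then c s else 0) \<noteq> 0"
    using assms by (simp add: in_keys_iff lookup_column_comb)
  then obtain s where "\<mu> \<in> col_orbit n s" by (metis (mono_tags, lifting) sum.neutral)
  then show "Poly_Mapping.keys \<mu> \<subseteq> {1..n}" by (simp add: col_orbit_def)
qed

lemma sum_one_column: "(\<Sum>j=1..i. Poly_Mapping.lookup (one_column r) j) = int (min i r)"
proof -
  have "(\<Sum>j=1..i. Poly_Mapping.lookup (one_column r) j) = (\<Sum>j\<in>{1..i} \<inter> {1..r}. 1)"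
    unfolding lookup_one_column by (rule sum.inter_restrict[symmetric]) simp
  also have "{1..i} \<inter> {1..r} = {1..min i r}" by auto
  finally show ?thesis by simp
qed

lemma one_column_inj: "one_column r = one_column s \<Longrightarrow> r = s"
  by (metis keys_one_column card_atLeastAtMost diff_Suc_1)

lemma partition_below_column:
  assumes "n \<ge> 1" "r \<le> n"
  shows "is_partition n \<mu> \<and> dominance_less n \<mu> (one_column r) \<longleftrightarrow> (\<exists>s<r. \<mu> = one_column s)"
proof
  assume "\<exists>s<r. \<mu> = one_column s"
  then obtain s where s: "s < r" "\<mu> = one_column s" by blast
  have "one_column s \<noteq> one_column r" using s(1) one_column_inj by blast
  then show "is_partition n \<mu> \<and> dominance_less n \<mu> (one_column r)"
    using assms s(1) unfolding is_partition_def dominance_less_def s(2) sum_one_column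
    by (auto simp: keys_one_column lookup_one_column)
next
  assume *: "is_partition n \<mu> \<and> dominance_less n \<mu> (one_column r)"
  let ?l = "Poly_Mapping.lookup \<mu>"
  have keys: "Poly_Mapping.keys \<mu> \<subseteq> {1..n}" and nonneg: "\<And>i. 0 \<le> ?l i"
    and decr: "\<And>i j. 1 \<le> i \<Longrightarrow> i \<le> j \<Longrightarrow> j \<le> n \<Longrightarrow> ?l j \<le> ?l i"
    using * by (auto simp: is_partition_def)
  have dom: "(\<Sum>j=1..i. ?l j) \<le> int (min i r)" if "i \<in> {1..n}" for i
    using * that unfolding dominance_less_def sum_one_column by blast
  have "?l 1 \<le> 1" using dom[of 1] assms by auto
  then have le1: "?l i \<le> 1" for i
    using decr[of 1 i] keys by (cases "i \<in> Poly_Mapping.keys \<mu>") (auto simp: in_keys_iff)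
  have one: "?l i = 1" if "i \<in> Poly_Mapping.keys \<mu>" for i
    using that nonneg[of i] le1[of i] by (auto simp: in_keys_iff)
  have "\<exists>s. Poly_Mapping.keys \<mu> = {1..s}"
  proof (cases "Poly_Mapping.keys \<mu> = {}")
    case True
    then show ?thesis by (intro exI[of _ 0]) simp
  next
    case False
    let ?m = "Max (Poly_Mapping.keys \<mu>)"
    have m: "?m \<in> Poly_Mapping.keys \<mu>" using False by simp
    have "Poly_Mapping.keys \<mu> = {1..?m}"
    proof (intro set_eqI iffI)
      fix i assume "i \<in> Poly_Mapping.keys \<mu>"
      then show "i \<in> {1..?m}" using keys by auto
    next
      fix i assume "i \<in> {1..?m}"
      then have "1 \<le> ?l i" using decr[of i ?m] one[OF m] m keys by auto
      then show "i \<in> Poly_Mapping.keys \<mu>" by (simp add: in_keys_iff)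
    qed
    then show ?thesis by blast
  qed
  then obtain s where s: "Poly_Mapping.keys \<mu> = {1..s}" by blast
  have eq: "\<mu> = one_column s"
  proof (rule poly_mapping_eqI)
    fix i show "?l i = Poly_Mapping.lookup (one_column s) i"
      using one[of i] s by (cases "i \<in> {1..s}") (auto simp: lookup_one_column simp flip: not_in_keys_iff_lookup_eq_zero)
  qed
  have "s \<le> n" using s keys assms by (cases "s = 0") auto
  then have "s \<le> r" using dom[of n] assms unfolding eq sum_one_column by simp
  moreover have "s \<noteq> r" using * eq by (auto simp: dominance_less_def)
  ultimately show "\<exists>s<r. \<mu> = one_column s" using eq by (intro exI[of _ s]) simp
qed

section \<open>One-column Koornwinder polynomials at the Schur specialization\<close>

lemma is_koornwinder_column_comb:
  assumes "n \<ge> 1" "r \<le> n" "is_koornwinder n (one_column r) a b c d q t P"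
  obtains k where "k r = 1" "P = column_comb n k r"
proof -
  let ?m = "\<lambda>s. monomial_sym n (one_column s)"
  obtain A u where A: "A \<subseteq> {\<mu>. is_partition n \<mu> \<and> dominance_less n \<mu> (one_column r)}"
    and P: "P = ?m r + (\<Sum>\<mu>\<in>A. laurent_const (u \<mu>) * monomial_sym n \<mu>)"
    using assms(3) by (auto simp: is_koornwinder_def)
  have sub: "A \<subseteq> one_column ` {..<r}" using A partition_below_column[OF assms(1,2)] by blast
  define k where "k s = (if s = r then 1 else if one_column s \<in> A then u (one_column s) else 0)" for s
  have zero: "laurent_const 0 = 0" and one: "laurent_const 1 = 1"
    by (simp_all add: laurent_const_def)
  have "(\<Sum>\<mu>\<in>A. laurent_const (u \<mu>) * monomial_sym n \<mu>) =
      (\<Sum>\<mu>\<in>one_column ` {..<r}. laurent_const (if \<mu> \<in> A then u \<mu> else 0) * monomial_sym n \<mu>)"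
    using sub by (intro sum.mono_neutral_cong_left) (auto simp: zero)
  also have "\<dots> = (\<Sum>s<r. laurent_const (k s) * ?m s)"
    by (subst sum.reindex) (auto simp: inj_on_def k_def dest: one_column_inj intro!: sum.cong)
  finally have "P = column_comb n k r"
    unfolding P column_comb_def lessThan_Suc_atMost[symmetric] by (simp add: k_def one add.commute)
  then show ?thesis using that[of k] by (simp add: k_def)
qed

lemma column_comb_dominance_form:
  assumes "n \<ge> 1" "r \<le> n" "k r = 1"
  shows "\<exists>A u. finite A \<and> A \<subseteq> {\<mu>. is_partition n \<mu> \<and> dominance_less n \<mu> (one_column r)} \<and>
    column_comb n k r = monomial_sym n (one_column r) + (\<Sum>\<mu>\<in>A. laurent_const (u \<mu>) * monomial_sym n \<mu>)"
proof (intro exI conjI)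
  let ?A = "one_column ` {..<r}" and ?u = "\<lambda>\<mu>. k (card (Poly_Mapping.keys \<mu>))"
  show "finite ?A" by simp
  show "?A \<subseteq> {\<mu>. is_partition n \<mu> \<and> dominance_less n \<mu> (one_column r)}"
    using partition_below_column[OF assms(1,2)] by blast
  have "(\<Sum>\<mu>\<in>?A. laurent_const (?u \<mu>) * monomial_sym n \<mu>) =
      (\<Sum>s<r. laurent_const (k s) * monomial_sym n (one_column s))"
    by (subst sum.reindex) (auto simp: inj_on_def keys_one_column dest: one_column_inj)
  then show "column_comb n k r = monomial_sym n (one_column r) +
      (\<Sum>\<mu>\<in>?A. laurent_const (?u \<mu>) * monomial_sym n \<mu>)"
    using assms(3) unfolding column_comb_def lessThan_Suc_atMost[symmetric]
    by (simp add: laurent_const_def add.commute)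
qed

lemma koornwinder_alpha_schur:
  assumes "s\<^sup>2 = q" "q \<noteq> 0"
  shows "(koornwinder_alpha s (- s) q (- q) q)\<^sup>2 = q\<^sup>2"
  unfolding koornwinder_alpha_def power2_csqrt using assms by (simp add: power2_eq_square)

lemma koornwinder_op_schur:
  assumes s: "s\<^sup>2 = q" and q: "q \<noteq> 0" and x: "koornwinder_regular n q x"
  shows "koornwinder_op n s (- s) q (- q) q q g x =
    schur_op n q g x / (koornwinder_alpha s (- s) q (- q) q * q ^ (n - 1))"
proof -
  define c where "c = koornwinder_alpha s (- s) q (- q) q * q ^ (n - 1)"
  have pref: "(1 - s * z) * (1 - (- s) * z) * (1 - q * z) * (1 - (- q) * z) /
      (c * (1 - z\<^sup>2) * (1 - q * z\<^sup>2)) = (1 - q\<^sup>2 * z\<^sup>2) / (1 - z\<^sup>2) / c"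
    if "q * z\<^sup>2 \<noteq> 1" for z
  proof -
    have "(1 - s * z) * (1 - (- s) * z) * (1 - q * z) * (1 - (- q) * z) =
        (1 - q\<^sup>2 * z\<^sup>2) * (1 - q * z\<^sup>2)"
      unfolding s[symmetric] by (simp add: algebra_simps power2_eq_square)
    then show ?thesis using that by simp
  qed
  have 1: "(1 - s * x i) * (1 - (- s) * x i) * (1 - q * x i) * (1 - (- q) * x i) /
        (koornwinder_alpha s (- s) q (- q) q * q ^ (n - 1) * (1 - (x i)\<^sup>2) * (1 - q * (x i)\<^sup>2)) *
      (\<Prod>j\<in>{1..n} - {i}. (1 - q * x i * x j) * (1 - q * x i / x j) / ((1 - x i * x j) * (1 - x i / x j)))
      = schur_coeff n q x i / c" if "i \<in> {1..n}" for i
    using pref[of "x i"] x that unfolding c_def[symmetric]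
    by (simp add: koornwinder_regular_def schur_coeff_def)
  let ?y = "\<lambda>i. inverse (x i)"
  have 2: "(1 - s / x i) * (1 - (- s) / x i) * (1 - q / x i) * (1 - (- q) / x i) /
        (koornwinder_alpha s (- s) q (- q) q * q ^ (n - 1) * (1 - 1 / (x i)\<^sup>2) * (1 - q / (x i)\<^sup>2)) *
      (\<Prod>j\<in>{1..n} - {i}. (1 - q * x j / x i) * (1 - q / (x i * x j)) / ((1 - x j / x i) * (1 - 1 / (x i * x j))))
      = schur_coeff n q ?y i / c" if i: "i \<in> {1..n}" for i
  proof -
    have "q * (?y i)\<^sup>2 \<noteq> 1"
      using x i by (auto simp: koornwinder_regular_def field_simps)
    note p = pref[OF this]
    have "(\<Prod>j\<in>{1..n} - {i}. (1 - q * x j / x i) * (1 - q / (x i * x j)) / ((1 - x j / x i) * (1 - 1 / (x i * x j)))) =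
        (\<Prod>j\<in>{1..n} - {i}. (1 - q * ?y i * ?y j) * (1 - q * ?y i / ?y j) / ((1 - ?y i * ?y j) * (1 - ?y i / ?y j)))"
      by (intro prod.cong) (simp_all add: divide_inverse mult_ac)
    moreover have "z / x i = z * ?y i" "z / (x i)\<^sup>2 = z * (?y i)\<^sup>2" for z
      by (simp_all add: divide_inverse power_inverse)
    ultimately show ?thesis unfolding c_def[symmetric] using p by (simp add: schur_coeff_def)
  qed
  show ?thesis unfolding koornwinder_op_def Let_def c_def[symmetric] schur_op_def
      add_divide_distrib sum_divide_distrib
    by (intro arg_cong2[of _ _ _ _ "(+)"] sum.cong refl)
      (simp_all only: 1[unfolded c_def[symmetric]] 2[unfolded c_def[symmetric]], simp_all)
qed

lemma koornwinder_eigenvalue_schur: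
  assumes s: "s\<^sup>2 = q" and q: "q \<noteq> 0" and n: "n \<ge> 1" and r: "r \<le> n"
  shows "koornwinder_eigenvalue n (one_column r) s (- s) q (- q) q q =
    schur_eigenvalue n q r / (koornwinder_alpha s (- s) q (- q) q * q ^ (n - 1))"
proof -
  define \<alpha> where "\<alpha> = koornwinder_alpha s (- s) q (- q) q"
  have \<alpha>2: "\<alpha>\<^sup>2 = q\<^sup>2" unfolding \<alpha>_def by (rule koornwinder_alpha_schur[OF s q])
  then have \<alpha>: "\<alpha> \<noteq> 0" using q by auto
  let ?t = "\<lambda>j. \<alpha> * q powi (int n - int j) * q powi (Poly_Mapping.lookup (one_column r) j)
         + inverse \<alpha> * q powi (- int n + int j) * q powi (- Poly_Mapping.lookup (one_column r) j)
         - \<alpha> * q powi (int n - int j) - inverse \<alpha> * q powi (- int n + int j)"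
  let ?h = "\<lambda>j. \<alpha> * q powi (int n - int j) + inverse \<alpha> * q powi (int j - int n)"
  have "koornwinder_eigenvalue n (one_column r) s (- s) q (- q) q q = (\<Sum>j=1..n. ?t j)"
    by (simp add: koornwinder_eigenvalue_def \<alpha>_def Let_def)
  also have "\<dots> = (\<Sum>j=1..r. ?t j)"
    using r by (intro sum.mono_neutral_right) (auto simp: lookup_one_column)
  also have "\<dots> = (\<Sum>j=1..r. ?h (j - 1) - ?h j)"
  proof (intro sum.cong refl)
    fix j assume j: "j \<in> {1..r}"
    then have "int n - int (j - 1) = (int n - int j) + 1" "int (j - 1) - int n = (- int n + int j) + (- 1)"
      by auto
    then have "q powi (int n - int (j - 1)) = q powi (int n - int j) * q powi 1"
      "q powi (int (j - 1) - int n) = q powi (- int n + int j) * q powi (- 1)"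
      by (simp_all only: power_int_add[OF disjI1[OF q]])
    moreover have "int j - int n = - int n + int j" by simp
    moreover have "a * u * x + b * v * y - a * u - b * v = a * (u * x) + b * (v * y) - (a * u + b * v)"
      for a b u v x y :: complex by (simp add: algebra_simps)
    ultimately show "?t j = ?h (j - 1) - ?h j"
      by (simp only: lookup_one_column j if_True)
  qed
  also have "\<dots> = ?h 0 - ?h r"
    by (induction r) simp_all
  also have "\<dots> = \<alpha> * q ^ n + inverse \<alpha> / q ^ n - \<alpha> * q ^ n / q ^ r - inverse \<alpha> * q ^ r / q ^ n"
    using q by (simp add: power_int_diff power_int_minus divide_inverse mult_ac)
  also have "\<dots> = (\<alpha>\<^sup>2 * q ^ n * q ^ n + 1 - \<alpha>\<^sup>2 * q ^ n * q ^ n / q ^ r - q ^ r) / (\<alpha> * q ^ n)"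
    using \<alpha> q by (simp add: field_simps power2_eq_square)
  also note \<alpha>2
  also have "q\<^sup>2 * q ^ n * q ^ n = q ^ (2 * n + 2)"
    by (simp add: power_add power2_eq_square mult_2)
  also have "(q ^ (2 * n + 2) + 1 - q ^ (2 * n + 2) / q ^ r - q ^ r) / (\<alpha> * q ^ n) =
      (1 + q ^ (2 * n + 2) - q ^ r - q ^ (2 * n + 2) / q ^ r) / (\<alpha> * q ^ n)"
    by (simp only: algebra_simps)
  also have "\<dots> = schur_eigenvalue n q r * q / (\<alpha> * q ^ n)"
    unfolding schur_eigenvalue_def using q by simp
  also have "q ^ n = q ^ (n - 1) * q" using n by (metis power_minus_mult less_eq_Suc_le One_nat_def)
  finally show ?thesis using q by (simp add: \<alpha>_def)
qed

lemma is_koornwinder_schur_iff: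
  assumes s: "s\<^sup>2 = q" and q: "q \<noteq> 0" "norm q < 1" and n: "n \<ge> 1" and r: "r \<le> n"
  shows "is_koornwinder n (one_column r) s (- s) q (- q) q q P \<longleftrightarrow>
    P = column_comb n (column_coeff n r) r"
proof -
  have "(koornwinder_alpha s (- s) q (- q) q)\<^sup>2 = q\<^sup>2" by (rule koornwinder_alpha_schur[OF s q(1)])
  then have c: "koornwinder_alpha s (- s) q (- q) q * q ^ (n - 1) \<noteq> 0" using q(1) by auto
  have cancel: "u / w = l / w * v \<longleftrightarrow> u = l * v" if "w \<noteq> 0" for u w l v :: complex
    using that by (simp add: field_simps)
  have eig: "koornwinder_op n s (- s) q (- q) q q g x =
      koornwinder_eigenvalue n (one_column r) s (- s) q (- q) q q * g x \<longleftrightarrow>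
      schur_op n q g x = schur_eigenvalue n q r * g x" if "koornwinder_regular n q x" for g x
    unfolding koornwinder_op_schur[OF s q(1) that] koornwinder_eigenvalue_schur[OF s q(1) n r]
    by (rule cancel[OF c])
  have eval: "laurent_eval (column_comb n k r) = (\<lambda>x. \<Sum>s\<le>r. k s * esym n s x)" for k
    by (rule ext) (rule laurent_eval_column_comb[OF r])
  have kc: "laurent_eval (column_comb n (column_coeff n r) r) = symp_char n r"
    unfolding eval by (rule ext) (rule symp_char_split[OF r, symmetric])
  show ?thesis
  proof
    assume P: "P = column_comb n (column_coeff n r) r"
    show "is_koornwinder n (one_column r) s (- s) q (- q) q q P"
      unfolding is_koornwinder_def P
      using column_comb_dominance_form[OF n r, of "column_coeff n r", OF column_coeff_refl]
      by (simp add: column_comb_laurent_in[OF r] column_comb_W_invariant[OF r] eig kc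
          schur_op_symp_char[OF regular_nodes_regular q(1)])
  next
    assume K: "is_koornwinder n (one_column r) s (- s) q (- q) q q P"
    then obtain k where k: "k r = 1" "P = column_comb n k r"
      using is_koornwinder_column_comb[OF n r] by blast
    define b where "b s = k s - column_coeff n r s" for s
    have diff: "(\<Sum>s<r. b s * esym n s x) = laurent_eval P x - symp_char n r x" for x
      unfolding symp_char_split[OF r] k(2) eval
      by (simp add: b_def k(1) column_coeff_refl left_diff_distrib sum_subtractf flip: lessThan_Suc_atMost)
    have "b s = 0" if "s < r" for s
    proof (rule eigen_zero[OF q r _ that])
      fix x assume x: "koornwinder_regular n q x"
      have "schur_op n q (laurent_eval P) x = schur_eigenvalue n q r * laurent_eval P x"
        using K x unfolding is_koornwinder_def eig[OF x, symmetric] by blast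
      moreover have "schur_op n q (symp_char n r) x = schur_eigenvalue n q r * symp_char n r x"
        by (rule schur_op_symp_char[OF regular_nodes_regular[OF x] q(1)])
      moreover have "schur_op n q (\<lambda>x. laurent_eval P x - symp_char n r x) x =
          schur_op n q (laurent_eval P) x - schur_op n q (symp_char n r) x"
        unfolding schur_op_def by (simp add: algebra_simps sum.distrib sum_subtractf)
      ultimately show "schur_op n q (\<lambda>x. \<Sum>s<r. b s * esym n s x) x = schur_eigenvalue n q r * (\<Sum>s<r. b s * esym n s x)"
        unfolding diff by (simp add: algebra_simps)
    qed
    then have "k s = column_coeff n r s" if "s \<le> r" for s
      using that k(1) by (cases "s = r") (auto simp: b_def column_coeff_refl)
    then show "P = column_comb n (column_coeff n r) r"
      unfolding k(2) column_comb_def by (intro sum.cong) auto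
  qed
qed

lemma column_comb_column_coeff:
  assumes "r \<le> n"
  shows "column_comb n (column_coeff n r) r =
    (\<Sum>k=0..r div 2. laurent_const (of_nat (n - r + 1) / of_nat (n - r + k + 1)
        * of_nat ((n - r + 2 * k) choose k)) * monomial_sym n (one_column (r - 2 * k)))"
proof -
  let ?f = "\<lambda>s. laurent_const (column_coeff n r s) * monomial_sym n (one_column s)"
  have "column_comb n (column_coeff n r) r = (\<Sum>s\<in>(\<lambda>k. r - 2 * k) ` {0..r div 2}. ?f s)"
    unfolding column_comb_def
  proof (rule sum.mono_neutral_right)
    show "\<forall>s\<in>{..r} - (\<lambda>k. r - 2 * k) ` {0..r div 2}. ?f s = 0"
    proof
      fix s assume s: "s \<in> {..r} - (\<lambda>k. r - 2 * k) ` {0..r div 2}"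
      have "odd (r - s)"
      proof
        assume "even (r - s)"
        then obtain k where "r - s = 2 * k" by (elim evenE)
        then have "s = r - 2 * k" "k \<le> r div 2" using s by auto
        then show False using s by auto
      qed
      then show "?f s = 0" by (simp add: column_coeff_odd laurent_const_def)
    qed
  qed auto
  also have "\<dots> = (\<Sum>k=0..r div 2. ?f (r - 2 * k))"
    by (subst sum.reindex) (auto simp: inj_on_def)
  also have "\<dots> = (\<Sum>k=0..r div 2. laurent_const (of_nat (n - r + 1) / of_nat (n - r + k + 1)
        * of_nat ((n - r + 2 * k) choose k)) * monomial_sym n (one_column (r - 2 * k)))"
  proof (intro sum.cong refl)
    fix k assume "k \<in> {0..r div 2}"
    then have "2 * k \<le> r" by auto
    then show "?f (r - 2 * k) = laurent_const (of_nat (n - r + 1) / of_nat (n - r + k + 1)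
        * of_nat ((n - r + 2 * k) choose k)) * monomial_sym n (one_column (r - 2 * k))"
      by (simp only: column_coeff_even[OF _ assms])
  qed
  finally show ?thesis .
qed

lemma column_f_schur:
  assumes "q \<noteq> 0" "norm q < 1"
  shows "column_f (csqrt q) q q (q ^ (i + 1)) = 1"
proof -
  define z where "z = q ^ (i + 1)"
  have z0: "z \<noteq> 0" using assms by (simp add: z_def)
  have pow: "q ^ m \<noteq> 1" if "m > 0" for m
  proof
    assume "q ^ m = 1"
    then have "norm q ^ m = 1" by (metis norm_power norm_one)
    moreover have "norm q ^ m < 1" using assms that by (simp add: power_less_one_iff)
    ultimately show False by simp
  qed
  have z1: "z\<^sup>2 \<noteq> 1" using pow[of "(i + 1) * 2"] unfolding z_def power_mult[symmetric] by simp
  have z2: "z\<^sup>2 * q\<^sup>2 \<noteq> 1"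
    using pow[of "(i + 1) * 2 + 2"] unfolding z_def power_mult[symmetric] power_add[symmetric] by simp
  have "column_f (csqrt q) q q z =
      ((1 - 1 / z\<^sup>2) * (1 - 1 / (z\<^sup>2 * q\<^sup>2))) / ((1 - 1 / (z\<^sup>2 * q\<^sup>2)) * (1 - 1 / z\<^sup>2))"
  proof (unfold column_f_def power2_csqrt, rule arg_cong2[of _ _ _ _ "(/)"])
    show "(1 - 1 / z) * (1 - q\<^sup>2 / (z * q * q\<^sup>2)) * (1 + q / (z * q)) * (1 + q / (z * q\<^sup>2)) =
        (1 - 1 / z\<^sup>2) * (1 - 1 / (z\<^sup>2 * q\<^sup>2))"
    proof -
      have "q\<^sup>2 / (z * q * q\<^sup>2) = 1 / (z * q)" "q / (z * q) = 1 / z" "q / (z * q\<^sup>2) = 1 / (z * q)"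
        using assms z0 by (simp_all add: power2_eq_square)
      moreover have "(1 - u) * (1 - v) * (1 + u) * (1 + v) = (1 - u\<^sup>2) * (1 - v\<^sup>2)" for u v :: complex
        by (simp add: algebra_simps power2_eq_square)
      ultimately show ?thesis by (simp add: power_divide power_mult_distrib)
    qed
    show "(1 - q / (z\<^sup>2 * q * q\<^sup>2)) * (1 - q ^ 3 / (z\<^sup>2 * q * q\<^sup>2)) =
        (1 - 1 / (z\<^sup>2 * q\<^sup>2)) * (1 - 1 / z\<^sup>2)"
      using assms z0 by (simp add: power2_eq_square power3_eq_cube)
  qed
  also have "\<dots> = 1" using z0 z1 z2 assms by simp
  finally show ?thesis by (simp add: z_def)
qed

theorem corollary1p2:
  fixes n r :: nat and q :: complex
  assumes "n \<ge> 1" and "r \<le> n" and "q \<noteq> 0" and "norm q < 1"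
  shows "(\<forall>i::nat. column_f (csqrt q) q q (q ^ (i + 1)) = 1) \<and>
         schur_C n (one_column r) q = macdonald_CC n (one_column r) q q q \<and>
         macdonald_CC n (one_column r) q q q =
           (\<Sum>k=0..r div 2.
              laurent_const (of_nat (n - r + 1) / of_nat (n - r + k + 1)
                * of_nat ((n - r + 2 * k) choose k))
              * monomial_sym n (one_column (r - 2 * k)))"
proof (intro conjI allI)
  show "column_f (csqrt q) q q (q ^ (i + 1)) = 1" for i
    using assms(3,4) by (rule column_f_schur)
  show "schur_C n (one_column r) q = macdonald_CC n (one_column r) q q q"
    by (simp add: schur_C_def)
  have "csqrt q * csqrt q = q" by (simp flip: power2_eq_square)
  then have "macdonald_CC n (one_column r) q q q = column_comb n (column_coeff n r) r"
    by (simp add: macdonald_CC_def koornwinder_def is_koornwinder_schur_iff[OF power2_csqrt assms(3,4,1,2)])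
  then show "macdonald_CC n (one_column r) q q q =
      (\<Sum>k=0..r div 2. laurent_const (of_nat (n - r + 1) / of_nat (n - r + k + 1)
        * of_nat ((n - r + 2 * k) choose k)) * monomial_sym n (one_column (r - 2 * k)))"
    by (simp only: column_comb_column_coeff[OF assms(2)])
qed

end
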